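(* For every $k\in\mathbb N_0$ the following hold as $n\to+\infty$: (i) $p^{(k)}_n\sim n\log^k n$; (ii) $p^{(k)}_{n+1}\sim p^{(k)}_n$; (iii) $\log p^{(k)}_n\sim\log n$.
   Context: Let $p_n$ denote the $n$-th prime number ($p_1=2$). Define $p^{(0)}_n=n$ and recursively $p^{(k+1)}_n=p_{p^{(k)}_n}$ for $k\in\mathbb N_0$ (iterated prime indexing). $\log$ is the natural logarithm, $\log^k n=(\log n)^k$, and $a_n\sim b_n$ means $a_n/b_n\to1$. *)

theory Defs
  imports "HOL-Analysis.Analysis" "HOL-Computational_Algebra.Primes" "HOL-Library.Infinite_Set"
begin

text \<open>p_n, the n-th prime, 1-indexed: p_1 = 2. (For n = 0 the value is an
irrelevant junk value; only n \<ge> 1 matters, and iterates of indices \<ge> 1 stay \<ge> 1.)\<close>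
definition nth_prime :: "nat \<Rightarrow> nat" where
  "nth_prime n = enumerate {p. prime p} (n - 1)"

definition iter_prime :: "nat \<Rightarrow> nat \<Rightarrow> nat" where
  "iter_prime k n = (nth_prime ^^ k) n"

end

theory Submission
  imports Defs "HOL-Number_Theory.Prime_Powers" "HOL-Real_Asymp.Real_Asymp"
    "HOL-Complex_Analysis.Complex_Analysis"
begin

text \<open>
  Everything reduces to the prime number theorem in the form \<open>p\<^sub>n \<sim> n ln n\<close>, which also gives
  \<open>ln p\<^sub>n \<sim> ln n\<close>; composing these two relations with the sequence \<open>p\<^sup>(\<^sup>k\<^sup>)\<close> gives the
  induction step, and the ratio of consecutive terms is then read off the main term.

  The prime number theorem is proved along the lines of Newman, with sums in place of
  integrals. Put \<open>G(s) = (s - 1) \<zeta>(s)\<close>, continued to \<open>Re s > 0\<close> by comparing \<open>n\<^sup>-\<^sup>s\<close> with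
  \<open>\<integral> x\<^sup>-\<^sup>s dx\<close> over \<open>[n, n + 1]\<close>. The convolution identity \<open>\<Sum>\<^sub>d\<^sub>|\<^sub>n \<Lambda>(d) = ln n\<close> gives
  \<open>\<Sum> \<Lambda>(n) n\<^sup>-\<^sup>s = 1/(s - 1) - G'(s)/G(s)\<close>; since the coefficients are nonnegative, \<open>G\<close> has no zero
  with \<open>Re s \<ge> 1\<close>. By Abel summation, \<open>\<Sum> (\<psi>(n) - n) n\<^sup>-\<^sup>s\<^sup>-\<^sup>1\<close> then continues holomorphically
  across \<open>Re s = 1\<close>. Its coefficients \<open>(\<psi>(n) - n)/n\<close> are bounded by Chebyshev's estimate, so
  Newman's theorem shows that \<open>\<Sum> (\<psi>(n) - n)/n\<^sup>2\<close> converges, and since \<open>\<psi>\<close> is monotone this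
  forces \<open>\<psi>(n) \<sim> n\<close>.
\<close>

section \<open>Dirichlet series\<close>

lemma norm_of_nat_powr: "norm (of_nat n powr s :: complex) = real n powr Re s"
  by (subst norm_powr_real_powr) auto

lemma has_field_derivative_nat_powr:
  fixes f :: "complex \<Rightarrow> complex"
  assumes "(f has_field_derivative f') (at s)"
  shows "((\<lambda>s. of_nat n powr f s :: complex) has_field_derivative
           ln (real n) * of_nat n powr f s * f') (at s)"
proof (cases "n = 0")
  case False
  then show ?thesis
    using DERIV_chain2[OF has_field_derivative_powr_right[of "of_nat n" "f s"] assms]
    by (simp add: Ln_of_nat)
qed simp

lemma holomorphic_series:
  fixes f :: "nat \<Rightarrow> complex \<Rightarrow> complex"
  assumes S: "open S" and hol: "\<And>n. f n holomorphic_on S"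
    and bd: "\<And>x. x \<in> S \<Longrightarrow> \<exists>d h. 0 < d \<and> summable h \<and>
               (\<forall>\<^sub>F n in sequentially. \<forall>y\<in>ball x d \<inter> S. norm (f n y) \<le> h n)"
  shows "(\<lambda>z. \<Sum>n. f n z) holomorphic_on S"
    and "\<And>z. z \<in> S \<Longrightarrow> summable (\<lambda>n. f n z)"
    and "\<And>z. z \<in> S \<Longrightarrow> (\<lambda>n. deriv (f n) z) sums deriv (\<lambda>z. \<Sum>n. f n z) z"
proof -
  obtain g g' where g: "\<forall>x\<in>S. (\<lambda>n. f n x) sums g x \<and> (\<lambda>n. deriv (f n) x) sums g' x
        \<and> (g has_field_derivative g' x) (at x)"
    using series_and_derivative_comparison_local[OF S holomorphic_derivI[OF hol S] bd]
    by blast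
  show sm: "summable (\<lambda>n. f n z)" if "z \<in> S" for z
    using g that by (auto simp: sums_iff)
  have d: "((\<lambda>z. \<Sum>n. f n z) has_field_derivative g' z) (at z)" if "z \<in> S" for z
    by (rule has_field_derivative_transform_within_open[of g _ _ S])
       (use g that S in \<open>auto simp: sums_iff\<close>)
  show "(\<lambda>z. \<Sum>n. f n z) holomorphic_on S"
    using d S by (auto simp: holomorphic_on_open)
  show "(\<lambda>n. deriv (f n) z) sums deriv (\<lambda>z. \<Sum>n. f n z) z" if "z \<in> S" for z
    using d[OF that] g that by (auto simp: DERIV_imp_deriv)
qed

lemma dirichlet_series:
  fixes a :: "nat \<Rightarrow> complex"
  assumes "\<And>x. x > 1 \<Longrightarrow> summable (\<lambda>n. norm (a n) * real n powr (-x))"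
  defines "S \<equiv> {s. Re s > 1}"
  shows dirichlet_series_holomorphic: "(\<lambda>s. \<Sum>n. a n * of_nat n powr (-s)) holomorphic_on S"
    and dirichlet_series_norm_summable:
      "\<And>s. Re s > 1 \<Longrightarrow> summable (\<lambda>n. norm (a n * of_nat n powr (-s)))"
    and dirichlet_series_deriv:
      "\<And>s. Re s > 1 \<Longrightarrow> (\<lambda>n. - ln (real n) * a n * of_nat n powr (-s)) sums
          deriv (\<lambda>s. \<Sum>n. a n * of_nat n powr (-s)) s"
proof -
  show "summable (\<lambda>n. norm (a n * of_nat n powr (-s)))" if "Re s > 1" for s
    using assms(1)[OF that] by (simp add: norm_mult norm_of_nat_powr)
  have op: "open S"
    unfolding S_def by (rule open_halfspace_Re_gt)
  have hol: "(\<lambda>s. a n * of_nat n powr (-s)) holomorphic_on S" for n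
    by (intro holomorphic_intros)
  have bd: "\<exists>d h. 0 < d \<and> summable h \<and> (\<forall>\<^sub>F n in sequentially. \<forall>y\<in>ball x d \<inter> S.
              norm (a n * of_nat n powr (-y)) \<le> h n)" if "x \<in> S" for x
  proof (intro exI conjI)
    \<comment> \<open>Half the distance to the line Re s = 1, so the whole ball lies in Re y \<ge> 1
      + \<open>?d\<close> and the terms at the real point 1 + \<open>?d\<close> serve as
      majorant.\<close>
    let ?d = "(Re x - 1) / 2"
    show "?d > 0" using that by (simp add: S_def)
    then show "summable (\<lambda>n. norm (a n) * real n powr (-(1 + ?d)))"
      by (intro assms) auto
    show "\<forall>\<^sub>F n in sequentially. \<forall>y\<in>ball x ?d \<inter> S.
        norm (a n * of_nat n powr (-y)) \<le> norm (a n) * real n powr (-(1 + ?d))"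
      using eventually_gt_at_top[of 0]
    proof eventually_elim
      case (elim n)
      show ?case
      proof
        fix y assume "y \<in> ball x ?d \<inter> S"
        then have "\<bar>Re (x - y)\<bar> < ?d"
          by (metis Int_iff abs_Re_le_cmod dist_norm le_less_trans mem_ball)
        then have "Re y \<ge> 1 + ?d"
          by (simp add: abs_if field_simps split: if_splits)
        then show "norm (a n * of_nat n powr (-y)) \<le> norm (a n) * real n powr (-(1 + ?d))"
          using elim unfolding norm_mult norm_of_nat_powr
          by (intro mult_left_mono powr_mono) auto
      qed
    qed
  qed
  note * = holomorphic_series[OF op hol bd]
  show "(\<lambda>s. \<Sum>n. a n * of_nat n powr (-s)) holomorphic_on S"
    by (rule *(1))
  show "(\<lambda>n. - ln (real n) * a n * of_nat n powr (-s)) sums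
          deriv (\<lambda>s. \<Sum>n. a n * of_nat n powr (-s)) s" if "Re s > 1" for s
  proof -
    have "((\<lambda>s. a n * of_nat n powr (-s)) has_field_derivative
             - ln (real n) * a n * of_nat n powr (-s)) (at s)" for n
      using DERIV_cmult[OF has_field_derivative_nat_powr[OF DERIV_minus[OF DERIV_ident]], of "a n" n s]
      by (simp add: mult_ac)
    from DERIV_imp_deriv[OF this] show ?thesis
      using *(3)[of s] that by (simp add: S_def)
  qed
qed

section \<open>Differences of powers and the comparison of a sum with its integral\<close>

lemma norm_powr_diff_le:
  fixes a b :: real
  assumes "0 < a" "a \<le> b" and w: "Re w \<ge> -1"
  shows "norm (of_real b powr (-w) - of_real a powr (-w) :: complex) \<le>
           norm w * a powr (-Re w - 1) * (b - a)"
proof -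
  have *: "\<exists>x. z = of_real x \<and> a \<le> x \<and> x \<le> b"
    if "z \<in> closed_segment (of_real a) (of_real b :: complex)" for z
    using that assms closed_segment_of_real[of a b, where ?'a = complex]
    by (auto simp: closed_segment_eq_real_ivl)
  have "norm (of_real b powr (-w) - of_real a powr (-w) :: complex) \<le>
          (norm w * a powr (-Re w - 1)) * norm (of_real b - of_real a :: complex)"
  proof (rule field_differentiable_bound[OF convex_closed_segment])
    fix z assume "z \<in> closed_segment (of_real a) (of_real b :: complex)"
    from *[OF this] obtain x where x: "z = of_real x" "a \<le> x" by auto
    then have "z \<notin> \<real>\<^sub>\<le>\<^sub>0" using assms by auto
    then show "((\<lambda>z. z powr (-w)) has_field_derivative (-w * z powr (-w - 1)))
        (at z within closed_segment (of_real a) (of_real b))"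
      by (auto intro!: derivative_eq_intros)
    have "norm (-w * z powr (-w - 1)) = norm w * x powr (-Re w - 1)"
      using x assms by (simp add: norm_mult norm_powr_real_powr)
    also have "\<dots> \<le> norm w * a powr (-Re w - 1)"
      using x assms by (intro mult_left_mono powr_mono2') auto
    finally show "norm (-w * z powr (-w - 1)) \<le> norm w * a powr (-Re w - 1)" .
  qed auto
  also have "norm (of_real b - of_real a :: complex) = b - a"
    using assms by (simp flip: of_real_diff)
  finally show ?thesis .
qed

text \<open>For n > 0 this is s times the difference between n^(-s-1) and the integral of x^(-s-1)
  over [n, n+1], with the integral evaluated, so that no division by s occurs.\<close>

definition euler_term :: "nat \<Rightarrow> complex \<Rightarrow> complex" where
  "euler_term n s = s * of_nat n powr (-s - 1) - of_nat n powr (-s) + of_nat (Suc n) powr (-s)"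

text \<open>Two mean value estimates in succession, each gaining a factor 1/n over the size n^(-Re
  s) of the individual powers. The condition on Re s lets \<open>norm_powr_diff_le\<close> apply to
  the exponent s + 1.\<close>

lemma norm_euler_term_le:
  assumes "n > 0" and s: "Re s \<ge> -2"
  shows "norm (euler_term n s) \<le> norm s * norm (s + 1) * real n powr (-Re s - 2)"
proof -
  define a where "a = real n"
  have a: "a > 0" using assms by (simp add: a_def)
  \<comment> \<open>The increment of \<open>f\<close> over [a, a+1] is the Euler term, while its
    derivative is again a difference of two powers, vanishing at \<open>a\<close>.\<close>
  define f where "f = (\<lambda>z::complex. z powr (-s) + s * of_real a powr (-s - 1) * z)"
  have *: "\<exists>x. z = of_real x \<and> a \<le> x \<and> x \<le> a + 1"
    if "z \<in> closed_segment (of_real a) (of_real (a + 1) :: complex)" for z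
    using that closed_segment_of_real[of a "a + 1", where ?'a = complex]
    by (auto simp: closed_segment_eq_real_ivl)
  have "norm (f (of_real (a + 1)) - f (of_real a)) \<le>
          (norm s * norm (s + 1) * a powr (-Re s - 2)) *
             norm (of_real (a + 1) - of_real a :: complex)"
  proof (rule field_differentiable_bound[OF convex_closed_segment])
    fix z assume "z \<in> closed_segment (of_real a) (of_real (a + 1) :: complex)"
    from *[OF this] obtain x where x: "z = of_real x" "a \<le> x" "x \<le> a + 1" by auto
    then have "z \<notin> \<real>\<^sub>\<le>\<^sub>0" using a by auto
    then show "(f has_field_derivative (-s * (z powr (-s - 1) - of_real a powr (-s - 1))))
        (at z within closed_segment (of_real a) (of_real (a + 1)))"
      unfolding f_def by (auto intro!: derivative_eq_intros simp: algebra_simps)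
    have "norm (of_real x powr (-(s + 1)) - of_real a powr (-(s + 1)) :: complex) \<le>
            norm (s + 1) * a powr (-Re (s + 1) - 1) * (x - a)"
      using a s x by (intro norm_powr_diff_le) auto
    also have "\<dots> \<le> norm (s + 1) * a powr (-Re (s + 1) - 1) * 1"
      using x by (intro mult_left_mono) auto
    finally have "norm s * norm (of_real x powr (-s - 1) - of_real a powr (-s - 1) :: complex) \<le>
                    norm s * (norm (s + 1) * a powr (-Re s - 2))"
      by (intro mult_left_mono) (auto simp: diff_diff_eq minus_add_distrib simp flip: diff_conv_add_uminus)
    then show "norm (-s * (z powr (-s - 1) - of_real a powr (-s - 1))) \<le>
                 norm s * norm (s + 1) * a powr (-Re s - 2)"
      by (simp add: x norm_mult mult_ac)
  qed auto
  also have "f (of_real (a + 1)) - f (of_real a) = euler_term n s"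
    by (simp add: f_def euler_term_def a_def algebra_simps)
  finally show ?thesis by (simp add: a_def)
qed

text \<open>Coefficients of growth n^k leave terms of order n^(k - Re s - 2), summable for Re s > k
  - 1. The case k = 0 continues zeta; k = 1 handles the error psi(n) - n.\<close>

lemma euler_term_series:
  fixes c :: "nat \<Rightarrow> complex" and k :: real
  assumes c: "\<And>n. n > 0 \<Longrightarrow> norm (c n) \<le> C * real n powr k" and "k \<ge> 0"
  shows euler_term_series_holomorphic:
      "(\<lambda>s. \<Sum>n. c n * euler_term n s) holomorphic_on {s. Re s > k - 1}"
    and euler_term_series_summable:
      "\<And>s. Re s > k - 1 \<Longrightarrow> summable (\<lambda>n. c n * euler_term n s)"
proof -
  let ?S = "{s. Re s > k - 1}"
  have C: "C \<ge> 0" using c[of 1] by (smt (verit) norm_ge_zero of_nat_1 powr_one_eq_one mult_cancel_left1 zero_less_one)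
  have op: "open ?S"
    by (rule open_halfspace_Re_gt)
  have hol: "(\<lambda>s. c n * euler_term n s) holomorphic_on ?S" for n
    unfolding euler_term_def by (intro holomorphic_intros)
  have bd: "\<exists>d h. 0 < d \<and> summable h \<and> (\<forall>\<^sub>F n in sequentially. \<forall>y\<in>ball x d \<inter> ?S.
              norm (c n * euler_term n y) \<le> h n)" if "x \<in> ?S" for x
  proof (intro exI conjI)
    let ?d = "(Re x - (k - 1)) / 2"
    let ?M = "norm x + ?d"
    show d: "?d > 0" using that by simp
    have "summable (\<lambda>n. real n powr (-(1 + ?d)))"
      using d by (subst summable_real_powr_iff) auto
    then show "summable (\<lambda>n. C * ?M * (?M + 1) * real n powr (-(1 + ?d)))"
      by (rule summable_mult)
    show "\<forall>\<^sub>F n in sequentially. \<forall>y\<in>ball x ?d \<inter> ?S.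
        norm (c n * euler_term n y) \<le> C * ?M * (?M + 1) * real n powr (-(1 + ?d))"
      using eventually_gt_at_top[of 0]
    proof eventually_elim
      case (elim n)
      show ?case
      proof
        fix y assume y: "y \<in> ball x ?d \<inter> ?S"
        then have "\<bar>Re (x - y)\<bar> < ?d"
          by (metis Int_iff abs_Re_le_cmod dist_norm le_less_trans mem_ball)
        then have Re: "Re y \<ge> (k - 1) + ?d"
          by (simp add: abs_if field_simps split: if_splits)
        have "norm y \<le> norm x + dist x y"
          by (metis dist_norm norm_minus_commute norm_triangle_sub)
        then have M: "norm y \<le> ?M" using y by (simp add: field_simps)
        then have M': "norm (y + 1) \<le> ?M + 1"
          by (metis add_mono_thms_linordered_semiring(3) norm_one norm_triangle_ineq order_trans)
        have "norm (c n * euler_term n y) \<le> (C * real n powr k) * (norm y * norm (y + 1) * real n powr (-Re y - 2))"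
          unfolding norm_mult using elim y \<open>k \<ge> 0\<close> d
          by (intro mult_mono c norm_euler_term_le) (auto simp: C)
        also have "\<dots> \<le> (C * real n powr k) * (?M * (?M + 1) * real n powr (-(k - 1 + ?d) - 2))"
          using M M' Re C d elim
          by (intro mult_left_mono mult_mono powr_mono) auto
        also have "\<dots> = C * ?M * (?M + 1) * (real n powr k * real n powr (-(k - 1 + ?d) - 2))"
          by simp
        also have "real n powr k * real n powr (-(k - 1 + ?d) - 2) = real n powr (-(1 + ?d))"
          by (simp flip: powr_add add: algebra_simps)
        finally show "norm (c n * euler_term n y) \<le> C * ?M * (?M + 1) * real n powr (-(1 + ?d))" .
      qed
    qed
  qed
  show "(\<lambda>s. \<Sum>n. c n * euler_term n s) holomorphic_on ?S"
    by (rule holomorphic_series(1)[OF op hol bd])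
  show "summable (\<lambda>n. c n * euler_term n s)" if "Re s > k - 1" for s
    by (rule holomorphic_series(2)[OF op hol bd]) (use that in auto)
qed

section \<open>The von Mangoldt function\<close>

definition psi :: "nat \<Rightarrow> real" where
  "psi n = (\<Sum>k\<le>n. mangoldt k)"

section \<open>Chebyshev's upper bound for psi\<close>

lemma psi_mono: "m \<le> n \<Longrightarrow> psi m \<le> psi n"
  unfolding psi_def by (intro sum_mono2) (auto simp: mangoldt_nonneg)

lemma psi_nonneg: "psi n \<ge> 0"
  unfolding psi_def by (intro sum_nonneg) (auto simp: mangoldt_nonneg)

text \<open>Passing from n to n + 1 raises \<open>n div d\<close> by one exactly at the divisors d
  of n + 1, and the sum of the von Mangoldt function over these is ln (n + 1).\<close>

lemma ln_fact_eq_sum_mangoldt: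
  "ln (fact n) = (\<Sum>d=1..n. mangoldt d * real (n div d))"
proof (induction n)
  case (Suc n)
  have "(\<Sum>d=1..Suc n. mangoldt d * real (Suc n div d)) =
          (\<Sum>d=1..Suc n. mangoldt d * real (n div d) + (if d dvd Suc n then mangoldt d else 0))"
    by (intro sum.cong refl) (auto simp: div_Suc dvd_eq_mod_eq_0 algebra_simps)
  also have "\<dots> = (\<Sum>d=1..Suc n. mangoldt d * real (n div d)) +
                  (\<Sum>d=1..Suc n. if d dvd Suc n then mangoldt d else 0)"
    by (rule sum.distrib)
  also have "(\<Sum>d=1..Suc n. if d dvd Suc n then mangoldt d else 0) = (\<Sum>d | d dvd Suc n. mangoldt d :: real)"
    by (subst sum.inter_filter [symmetric])
       (auto intro!: sum.cong simp: Suc_le_eq dest: dvd_imp_le dvd_pos_nat[rotated])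
  also have "\<dots> = ln (real (Suc n))"
    by (subst mangoldt_sum) auto
  also have "(\<Sum>d=1..Suc n. mangoldt d * real (n div d)) = ln (fact n)"
    by (simp add: Suc)
  finally show ?case by (simp add: ln_mult)
qed simp

text \<open>Chebyshev's argument with the central binomial coefficient: in the expansion of its
  logarithm, \<open>mangoldt d\<close> has the nonnegative coefficient floor(2n/d) - 2 floor(n/d),
  which is 1 for n < d \<le> 2n. The bound 4^n and ln 2 < 1 finish it.\<close>

lemma psi_double_le: "psi (2 * n) - psi n \<le> 2 * real n"
proof -
  have "psi (2 * n) - psi n = (\<Sum>d\<in>{..2*n} - {..n}. mangoldt d)"
    unfolding psi_def by (intro sum_diff [symmetric]) auto
  also have "\<dots> \<le> (\<Sum>d\<in>{..2*n} - {..n}. mangoldt d * (real (2 * n div d) - 2 * real (n div d)))"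
  proof (intro sum_mono)
    fix d assume d: "d \<in> {..2*n} - {..n}"
    then have "2 * n div d = 1" by (intro div_nat_eqI) auto
    then show "mangoldt d \<le> mangoldt d * (real (2 * n div d) - 2 * real (n div d))"
      using d by simp
  qed
  also have "\<dots> \<le> (\<Sum>d=1..2*n. mangoldt d * (real (2 * n div d) - 2 * real (n div d)))"
  proof (intro sum_mono2)
    fix d
    have "2 * (n div d) \<le> 2 * n div d"
      by (cases "d = 0") (simp_all add: less_eq_div_iff_mult_less_eq mult.assoc)
    then have "2 * real (n div d) \<le> real (2 * n div d)"
      by (metis of_nat_le_iff of_nat_mult of_nat_numeral)
    then show "0 \<le> mangoldt d * (real (2 * n div d) - 2 * real (n div d))"
      by (simp add: mangoldt_nonneg)
  qed auto
  also have "\<dots> = (\<Sum>d=1..2*n. mangoldt d * real (2 * n div d)) - 2 * (\<Sum>d=1..2*n. mangoldt d * real (n div d))"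
    by (simp add: sum_distrib_left sum_subtractf algebra_simps)
  \<comment> \<open>For d > n the quotient \<open>n div d\<close> is 0.\<close>
  also have "(\<Sum>d=1..2*n. mangoldt d * real (n div d)) = (\<Sum>d=1..n. mangoldt d * real (n div d))"
    by (rule sum.mono_neutral_right) auto
  also have "(\<Sum>d=1..2*n. mangoldt d * real (2 * n div d)) - 2 * (\<Sum>d=1..n. mangoldt d * real (n div d))
               = ln (fact (2 * n)) - 2 * ln (fact n)"
    by (simp only: ln_fact_eq_sum_mangoldt)
  also have "\<dots> = ln (real (2 * n choose n))"
    by (simp add: binomial_fact ln_div ln_mult)
  also have "\<dots> \<le> ln (2 ^ (2 * n))"
    using binomial_le_pow2[of "2 * n" n]
    by (subst ln_le_cancel_iff) (auto simp flip: of_nat_le_iff)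
  also have "\<dots> = real (2 * n) * ln 2"
    by (simp add: ln_realpow)
  also have "\<dots> \<le> real (2 * n) * 1"
    using ln_2_less_1 by (intro mult_left_mono) auto
  finally show ?thesis by simp
qed

text \<open>Strong induction by halving: with m = n/2 rounded up, psi(n) \<le> psi(2m) \<le> psi(m)
  + 2m \<le> 6m.\<close>

lemma psi_le: "psi n \<le> 4 * real n"
proof (induction n rule: less_induct)
  case (less n)
  consider "n \<le> 1" | "n > 1" by linarith
  then show ?case
  proof cases
    case 1
    then have "n = 0 \<or> n = 1" by auto
    then show ?thesis by (auto simp: psi_def)
  next
    case 2
    define m where "m = (n + 1) div 2"
    have m: "m < n" "n \<le> 2 * m" "2 * m \<le> n + 1" using 2 by (auto simp: m_def)
    show ?thesis
    proof (cases "even n")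
      case True
      then have "n = 2 * m" by (auto simp: m_def)
      then show ?thesis using psi_double_le[of m] less[OF m(1)] by simp
    next
      case False
      \<comment> \<open>Here 6m \<le> 4(2m - 1) is required, which is m \<ge> 2.\<close>
      then have "n = 2 * m - 1" "m \<ge> 2" using 2 by (auto simp: m_def elim!: oddE)
      then show ?thesis using psi_double_le[of m] less[OF m(1)] psi_mono[OF m(2)] by simp
    qed
  qed
qed

section \<open>The convolution identity as a product of Dirichlet series\<close>

lemma summable_ln_powr:
  assumes "x > 1"
  shows "summable (\<lambda>n. ln (real n) * real n powr (-x))"
proof (rule summable_comparison_test')
  \<comment> \<open>Half of the excess of x over 1 absorbs the logarithm; the other half keeps the
    series convergent.\<close>
  let ?e = "(x - 1) / 2"
  show "summable (\<lambda>n. real n powr (-(1 + ?e)) / ?e)"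
    using assms by (intro summable_divide, subst summable_real_powr_iff) auto
  fix n :: nat assume n: "n \<ge> 1"
  have "ln (real n) * real n powr (-x) \<le> real n powr ?e / ?e * real n powr (-x)"
    using n assms by (intro mult_right_mono ln_powr_bound) auto
  also have "\<dots> = (real n powr ?e * real n powr (-x)) / ?e"
    by simp
  also have "real n powr ?e * real n powr (-x) = real n powr (-(1 + ?e))"
  proof -
    have "?e + (-x) = -(1 + ?e)" by (simp add: field_simps)
    then show ?thesis by (metis powr_add)
  qed
  finally show "norm (ln (real n) * real n powr (-x)) \<le> real n powr (-(1 + ?e)) / ?e"
    using n by simp
qed

lemma summable_mangoldt_powr:
  assumes "x > 1"
  shows "summable (\<lambda>n. norm (mangoldt n :: complex) * real n powr (-x))"
proof (rule summable_comparison_test'[OF summable_ln_powr[OF assms]])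
  fix n :: nat assume n: "n \<ge> 1"
  then show "norm (norm (mangoldt n :: complex) * real n powr (-x)) \<le> ln (real n) * real n powr (-x)"
    using mangoldt_le[of n] by (auto intro!: mult_right_mono simp: mangoldt_nonneg)
qed

text \<open>The absolutely convergent double sum over pairs (d, m) is regrouped by the product n = d
  m, and the inner sum over the divisors of n is ln n.\<close>

lemma mangoldt_dirichlet_product:
  fixes s :: complex
  assumes s: "Re s > 1"
  shows "(\<lambda>n. ln (real n) * of_nat n powr (-s)) sums
           ((\<Sum>n. mangoldt n * of_nat n powr (-s)) * (\<Sum>n. of_nat n powr (-s)) :: complex)"
proof -
  define A where "A = (\<lambda>n. mangoldt n * of_nat n powr (-s) :: complex)"
  define B where "B = (\<lambda>n. of_nat n powr (-s) :: complex)"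
  have A: "summable (\<lambda>n. norm (A n))"
    unfolding A_def using summable_mangoldt_powr s by (intro dirichlet_series_norm_summable)
  have B: "summable (\<lambda>n. norm (B n))"
    using s by (simp add: B_def norm_of_nat_powr summable_real_powr_iff)
  have hA: "(A has_sum suminf A) UNIV" and hB: "(B has_sum suminf B) UNIV"
    by (intro norm_summable_imp_has_sum A B summable_sums summable_norm_cancel)+
  have hnB: "((\<lambda>n. norm (B n)) has_sum (\<Sum>n. norm (B n))) UNIV"
    by (intro norm_summable_imp_has_sum summable_sums) (use B in auto)
  have "(\<lambda>x. norm (case x of (d,m) \<Rightarrow> A d * B m)) summable_on UNIV \<times> UNIV"
  proof (rule summable_on_SigmaI)
    show "((\<lambda>m. norm (case (d, m) of (d, m) \<Rightarrow> A d * B m)) has_sum norm (A d) * (\<Sum>n. norm (B n))) UNIV" for d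
      using has_sum_cmult_right[OF hnB, of "norm (A d)"] by (simp add: norm_mult)
    show "(\<lambda>d. norm (A d) * (\<Sum>n. norm (B n))) summable_on UNIV"
      using A by (intro summable_on_cmult_left norm_summable_imp_summable_on) auto
  qed auto
  then have sm: "(\<lambda>(d,m). A d * B m) summable_on UNIV \<times> UNIV"
    by (rule abs_summable_summable)
  have "((\<lambda>(d,m). A d * B m) has_sum (suminf A * suminf B)) (UNIV \<times> UNIV)"
  proof (rule has_sum_SigmaI[OF _ _ sm])
    show "((\<lambda>m. case (d, m) of (d, m) \<Rightarrow> A d * B m) has_sum A d * suminf B) UNIV" for d
      using has_sum_cmult_right[OF hB, of "A d"] by simp
    show "((\<lambda>d. A d * suminf B) has_sum suminf A * suminf B) UNIV"
      by (rule has_sum_cmult_left[OF hA])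
  qed
  \<comment> \<open>Since \<open>0 powr z = 0\<close>, pairs with a zero component contribute
    nothing; without them every product has only finitely many factorizations.\<close>
  also have "?this \<longleftrightarrow> ((\<lambda>(d,m). A d * B m) has_sum (suminf A * suminf B)) ({1..} \<times> {1..})"
    by (intro has_sum_cong_neutral) (auto simp: A_def B_def not_le Suc_le_eq)
  also have "\<dots> \<longleftrightarrow> ((\<lambda>(n,d). A d * B (n div d)) has_sum (suminf A * suminf B)) (Sigma {1..} (\<lambda>n. {d. d dvd n}))"
    by (rule has_sum_reindex_bij_witness[where i = "\<lambda>(n,d). (d, n div d)" and j = "\<lambda>(d,m). (d * m, d)"])
       (auto simp: Suc_le_eq dvd_pos_nat dvd_imp_le div_greater_zero_iff intro: Nat.gr0I)
  finally have "((\<lambda>n. \<Sum>d | d dvd n. A d * B (n div d)) has_sum (suminf A * suminf B)) {1..}"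
    by (rule has_sum_SigmaD) (auto intro!: has_sum_finiteI)
  also have "?this \<longleftrightarrow> ((\<lambda>n. ln (real n) * of_nat n powr (-s)) has_sum (suminf A * suminf B)) UNIV"
  proof (rule has_sum_cong_neutral)
    fix n :: nat assume "n \<in> {1..} \<inter> UNIV"
    then have n: "n > 0" by auto
    have "(\<Sum>d | d dvd n. A d * B (n div d)) = (\<Sum>d | d dvd n. mangoldt d * of_nat n powr (-s))"
    proof (intro sum.cong refl)
      fix d assume "d \<in> {d. d dvd n}"
      then obtain m where m: "n = d * m" by auto
      then have "d > 0" "m > 0" using n by auto
      have "(of_nat n :: complex) powr (-s) = of_nat d powr (-s) * of_nat m powr (-s)"
        by (simp add: m powr_times_real)
      then show "A d * B (n div d) = mangoldt d * of_nat n powr (-s)"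
        using \<open>d > 0\<close> by (simp add: A_def B_def m)
    qed
    also have "\<dots> = ln (real n) * of_nat n powr (-s)"
      using n by (simp add: mangoldt_sum flip: sum_distrib_right)
    finally show "(\<Sum>d | d dvd n. A d * B (n div d)) = ln (real n) * of_nat n powr (-s)" .
  qed auto
  finally show ?thesis
    unfolding A_def B_def by (rule has_sum_imp_sums)
qed

section \<open>Zeros of the zeta function\<close>

definition zeta_series :: "complex \<Rightarrow> complex" where
  "zeta_series s = (\<Sum>n. of_nat n powr (-s))"

definition mangoldt_series :: "complex \<Rightarrow> complex" where
  "mangoldt_series s = (\<Sum>n. mangoldt n * of_nat n powr (-s))"

text \<open>
  The entire terms \<^term>\<open>euler_term n (s - 1)\<close> telescope up to \<open>(s - 1) n\<^sup>-\<^sup>s\<close>, so that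
  the following series continues \<open>(s - 1) \<zeta>(s)\<close>. Since \<open>0 powr z = 0\<close>, the term for
  \<open>n = 0\<close> is the constant 1.
\<close>

definition reg_zeta :: "complex \<Rightarrow> complex" where
  "reg_zeta s = (\<Sum>n. euler_term n (s - 1))"

lemma reg_zeta_holomorphic: "reg_zeta holomorphic_on {s. Re s > 0}"
proof -
  have "(\<lambda>s. \<Sum>n. 1 * euler_term n s) holomorphic_on {s. Re s > 0 - 1}"
    by (rule euler_term_series_holomorphic[where C = 1]) auto
  then have "((\<lambda>s. \<Sum>n. euler_term n s) \<circ> (\<lambda>s. s - 1)) holomorphic_on {s. Re s > 0}"
    by (intro holomorphic_on_compose_gen[where t = "{s. Re s > 0 - 1}"] holomorphic_intros) auto
  then show ?thesis by (simp add: reg_zeta_def [abs_def] o_def)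
qed

lemma reg_zeta_1: "reg_zeta 1 = 1"
proof -
  have "reg_zeta 1 = (\<Sum>n\<in>{0}. euler_term n 0)"
    unfolding reg_zeta_def
    \<comment> \<open>For n > 0 the term is 0 - 1 + 1 = 0; at n = 0 the convention
      \<open>0 powr 0 = 0\<close> leaves 1.\<close>
    by (subst suminf_finite[of "{0}"]) (auto simp: euler_term_def simp del: of_nat_Suc)
  then show ?thesis by (simp add: euler_term_def)
qed

lemma summable_norm_zeta: "Re s > 1 \<Longrightarrow> summable (\<lambda>n. norm (of_nat n powr (-s) :: complex))"
  by (simp add: norm_of_nat_powr summable_real_powr_iff)

lemma powr_tendsto_0:
  assumes "Re s < 0"
  shows "(\<lambda>n. of_nat n powr s :: complex) \<longlonglongrightarrow> 0"
proof (rule tendsto_norm_zero_cancel)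
  show "(\<lambda>n. norm (of_nat n powr s :: complex)) \<longlonglongrightarrow> 0"
    unfolding norm_of_nat_powr
    by (rule tendsto_neg_powr[OF assms filterlim_real_sequentially])
qed

lemma reg_zeta_eq:
  assumes "Re s > 1"
  shows "reg_zeta s = (s - 1) * zeta_series s"
proof -
  have sm: "summable (\<lambda>n. of_nat n powr (-s) :: complex)"
    by (rule summable_norm_cancel[OF summable_norm_zeta[OF assms]])
  \<comment> \<open>Starting the telescope at index 0, where the power is 0 by convention, makes its
    sum 0; the constant term 1 of \<open>reg_zeta\<close> is absorbed this way.\<close>
  have "(\<lambda>n. of_nat (Suc n) powr (1 - s) - of_nat n powr (1 - s)) sums (0 - of_nat 0 powr (1 - s) :: complex)"
    by (rule telescope_sums[OF powr_tendsto_0]) (use assms in auto)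
  then have "(\<lambda>n. (s - 1) * of_nat n powr (-s) + (of_nat (Suc n) powr (1 - s) - of_nat n powr (1 - s))) sums
               ((s - 1) * zeta_series s + 0)"
    unfolding zeta_series_def
    by (intro sums_add sums_mult summable_sums sm) auto
  also have "(\<lambda>n. (s - 1) * of_nat n powr (-s) + (of_nat (Suc n) powr (1 - s) - of_nat n powr (1 - s)))
               = (\<lambda>n. euler_term n (s - 1))"
    by (simp add: euler_term_def algebra_simps)
  finally show ?thesis by (simp add: sums_iff reg_zeta_def)
qed

text \<open>The identity for -zeta'/zeta with zeta = G/(s - 1), multiplied through by G so that it
  can be used before G is known to be zero-free.\<close>

lemma mangoldt_series_times_reg_zeta:
  assumes s: "Re s > 1"
  shows "mangoldt_series s * reg_zeta s = reg_zeta s / (s - 1) - deriv reg_zeta s"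
proof -
  have s1: "s \<noteq> 1" using s by auto
  have sm: "summable (\<lambda>n. norm (1 :: complex) * real n powr (-x))" if "x > 1" for x
    using that by (simp add: summable_real_powr_iff)
  have "(\<lambda>n. ln (real n) * of_nat n powr (-s)) sums (- deriv zeta_series s)"
    using sums_minus[OF dirichlet_series_deriv[OF sm s]] by (simp add: zeta_series_def [abs_def])
  moreover have "(\<lambda>n. ln (real n) * of_nat n powr (-s)) sums (mangoldt_series s * zeta_series s)"
    using mangoldt_dirichlet_product[OF s] by (simp add: mangoldt_series_def zeta_series_def)
  ultimately have *: "mangoldt_series s * zeta_series s = - deriv zeta_series s"
    by (metis sums_unique2)
  have "(reg_zeta has_field_derivative deriv reg_zeta s) (at s)"
    by (rule holomorphic_derivI[OF reg_zeta_holomorphic open_halfspace_Re_gt]) (use s in auto)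
  then have "((\<lambda>s. reg_zeta s / (s - 1)) has_field_derivative
        (deriv reg_zeta s / (s - 1) - reg_zeta s / (s - 1)\<^sup>2)) (at s)"
    using s1 by (auto intro!: derivative_eq_intros simp: power2_eq_square divide_simps)
  then have "(zeta_series has_field_derivative
        (deriv reg_zeta s / (s - 1) - reg_zeta s / (s - 1)\<^sup>2)) (at s)"
    by (rule has_field_derivative_transform_within_open[OF _ open_halfspace_Re_gt[of 1]])
       (use s in \<open>auto simp: reg_zeta_eq\<close>)
  then have "mangoldt_series s * zeta_series s = - (deriv reg_zeta s / (s - 1) - reg_zeta s / (s - 1)\<^sup>2)"
    using * by (simp add: DERIV_imp_deriv)
  then have "(s - 1) * (mangoldt_series s * zeta_series s) =
      (s - 1) * - (deriv reg_zeta s / (s - 1) - reg_zeta s / (s - 1)\<^sup>2)"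
    by simp
  also have "\<dots> = reg_zeta s / (s - 1) - deriv reg_zeta s"
  proof -
    have "u * - (a / u - b / u\<^sup>2) = b / u - a" if "u \<noteq> 0" for u a b :: complex
      using that by (simp add: field_simps power2_eq_square)
    then show ?thesis using s1 by simp
  qed
  finally show ?thesis
    using reg_zeta_eq[OF s] by (simp add: mult_ac)
qed

section \<open>Orders of vanishing and zero-freeness for Re s \<ge> 1\<close>

text \<open>
  If \<open>(s - 1) \<zeta>(s) = (s - s\<^sub>0)\<^sup>m g(s)\<close> with \<open>g\<close> zero-free, then \<open>-m\<close> is the residue of
  the logarithmic derivative, up to the contribution of the factor \<open>s - 1\<close>.
\<close>

lemma mangoldt_series_residue:
  assumes "Re s0 \<ge> 1" "r > 0" and hol: "g holomorphic_on ball s0 r"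
    and G: "\<And>w. w \<in> ball s0 r \<Longrightarrow> reg_zeta w = (w - s0) ^ m * g w"
    and nz: "\<And>w. w \<in> ball s0 r \<Longrightarrow> g w \<noteq> 0"
  shows "((\<lambda>e. of_real e * mangoldt_series (s0 + of_real e)) \<longlongrightarrow>
           (if s0 = 1 then 1 else 0) - of_nat m) (at_right 0)"
proof -
  \<comment> \<open>This is \<open>of_real e * mangoldt_series (s0 + of_real e)\<close> for small e
    > 0, rewritten by the factorization; the first summand tends to 1 or 0 according to whether s0 =
    1, the last one to 0.\<close>
  define L where "L = (\<lambda>e. of_real e / (s0 + of_real e - 1) - of_nat m -
      of_real e * (deriv g (s0 + of_real e) / g (s0 + of_real e)) :: complex)"
  have "(\<lambda>w. deriv g w / g w) holomorphic_on ball s0 r"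
    using hol nz by (intro holomorphic_intros) auto
  then have cont: "isCont (\<lambda>w. deriv g w / g w) s0"
    using \<open>r > 0\<close> holomorphic_on_imp_continuous_on continuous_on_interior
    by (metis centre_in_ball interior_ball)
  have lim: "((\<lambda>e. s0 + of_real e) \<longlongrightarrow> s0) (at_right (0::real))"
    by (auto intro!: tendsto_eq_intros)
  have "((\<lambda>e. of_real e / (s0 + of_real e - 1)) \<longlongrightarrow> (if s0 = 1 then 1 else 0 :: complex)) (at_right (0::real))"
  proof (cases "s0 = 1")
    case True
    have "((\<lambda>e. 1) \<longlongrightarrow> (1::complex)) (at_right (0::real))" by simp
    then show ?thesis
      unfolding True if_P[OF refl]
      by (rule Lim_transform_eventually) (auto simp: eventually_at_filter)
  next
    case False
    have "((\<lambda>e. of_real e / (s0 + of_real e - 1)) \<longlongrightarrow> of_real 0 / (s0 + of_real 0 - 1)) (at_right (0::real))"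
      by (intro tendsto_intros) (use False in auto)
    then show ?thesis using False by simp
  qed
  note lim1 = this
  have lim2: "((\<lambda>e. of_real e * (deriv g (s0 + of_real e) / g (s0 + of_real e))) \<longlongrightarrow>
      of_real 0 * (deriv g s0 / g s0)) (at_right (0::real))"
    by (intro tendsto_mult tendsto_of_real tendsto_ident_at isCont_tendsto_compose[OF cont lim])
  have L: "(L \<longlongrightarrow> (if s0 = 1 then 1 else 0) - of_nat m) (at_right 0)"
    unfolding L_def using tendsto_diff[OF tendsto_diff[OF lim1 tendsto_const] lim2] by simp
  have "\<forall>\<^sub>F e in at_right (0::real). e \<in> {0<..<r}"
    using \<open>r > 0\<close> by (rule eventually_at_right_real)
  then have "\<forall>\<^sub>F e in at_right 0. L e = of_real e * mangoldt_series (s0 + of_real e)"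
  proof eventually_elim
    case (elim e)
    define w where "w = s0 + of_real e"
    have e: "e > 0" "e < r" using elim by auto
    have w: "w \<in> ball s0 r" using e by (simp add: w_def dist_norm)
    have Re: "Re w > 1" using e assms(1) by (simp add: w_def)
    have w0: "w - s0 = of_real e" "w - s0 \<noteq> 0" using e by (auto simp: w_def)
    have "w \<noteq> 1" using Re by force
    have "(g has_field_derivative deriv g w) (at w)"
      by (rule holomorphic_derivI[OF hol _ w]) auto
    then have "((\<lambda>w. (w - s0) ^ m * g w) has_field_derivative
        (of_nat m * (w - s0) ^ (m - 1) * g w + (w - s0) ^ m * deriv g w)) (at w)"
      by (auto intro!: derivative_eq_intros)
    then have "(reg_zeta has_field_derivative
        (of_nat m * (w - s0) ^ (m - 1) * g w + (w - s0) ^ m * deriv g w)) (at w)"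
      by (rule has_field_derivative_transform_within_open[OF _ open_ball w]) (simp add: G)
    then have d: "deriv reg_zeta w = of_nat m * (w - s0) ^ (m - 1) * g w + (w - s0) ^ m * deriv g w"
      by (rule DERIV_imp_deriv)
    \<comment> \<open>The extra factor turns the exponent \<open>m - 1\<close> into
      \<open>m\<close>, so m = 0 needs no separate formula.\<close>
    have D: "(w - s0) * deriv reg_zeta w = of_nat m * (w - s0) ^ m * g w + (w - s0) * (w - s0) ^ m * deriv g w"
      unfolding d by (cases m) (simp_all add: algebra_simps)
    have "((w - s0) * mangoldt_series w) * ((w - s0) ^ m * g w) = (w - s0) * (mangoldt_series w * reg_zeta w)"
      by (simp add: G[OF w])
    also have "\<dots> = (w - s0) * ((w - s0) ^ m * g w) / (w - 1) - (w - s0) * deriv reg_zeta w"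
      by (subst mangoldt_series_times_reg_zeta[OF Re]) (simp add: right_diff_distrib G[OF w])
    also have "\<dots> = ((w - s0) / (w - 1) - of_nat m - (w - s0) * (deriv g w / g w)) * ((w - s0) ^ m * g w)"
    proof -
      have "d * (P * b) / x - (k * P * b + d * P * b') = (d / x - k - d * (b' / b)) * (P * b)"
        if "b \<noteq> 0" for d P b x k b' :: complex
        using that by (simp add: algebra_simps)
      then show ?thesis unfolding D using nz[OF w] .
    qed
    finally have "((w - s0) * mangoldt_series w) * ((w - s0) ^ m * g w) = \<dots>" .
    then have "(w - s0) * mangoldt_series w = (w - s0) / (w - 1) - of_nat m - (w - s0) * (deriv g w / g w)"
      using nz[OF w] w0 by simp
    then show ?case unfolding L_def w0(1) by (simp add: w_def)
  qed
  with L show ?thesis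
    by (rule Lim_transform_eventually)
qed

text \<open>Zeros and non-zeros are put in one form: at a zero, \<open>m\<close> is its order;
  elsewhere m = 0 and g is \<open>reg_zeta\<close> itself on a small ball.\<close>

lemma reg_zeta_factor:
  assumes "Re s0 \<ge> 1"
  obtains m r g where "r > 0" "g holomorphic_on ball s0 r"
    "\<And>w. w \<in> ball s0 r \<Longrightarrow> reg_zeta w = (w - s0) ^ m * g w"
    "\<And>w. w \<in> ball s0 r \<Longrightarrow> g w \<noteq> 0"
    "m = 0 \<longleftrightarrow> reg_zeta s0 \<noteq> 0"
proof (cases "reg_zeta s0 = 0")
  case True
  \<comment> \<open>The value at 1 is 1, whereas the value at s0 is 0.\<close>
  have "\<not> reg_zeta constant_on {s. Re s > 0}"
  proof
    assume "reg_zeta constant_on {s. Re s > 0}"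
    then obtain c where "\<And>s. Re s > 0 \<Longrightarrow> reg_zeta s = c" by (auto simp: constant_on_def)
    from this[of 1] this[of s0] show False using True assms reg_zeta_1 by auto
  qed
  with True assms holomorphic_factor_zero_nonconstant[OF reg_zeta_holomorphic open_halfspace_Re_gt
      convex_connected[OF convex_halfspace_Re_gt], of s0]
  show ?thesis using that by (metis (no_types, lifting) less_le_trans mem_Collect_eq zero_less_one less_irrefl)
next
  case False
  have s0: "s0 \<in> {s. Re s > 0}" using assms by simp
  have "isCont reg_zeta s0"
    using reg_zeta_holomorphic s0
    by (metis continuous_on_eq_continuous_at holomorphic_on_imp_continuous_on open_halfspace_Re_gt)
  then obtain d where d: "d > 0" "\<And>w. dist s0 w < d \<Longrightarrow> reg_zeta w \<noteq> 0"
    using continuous_at_avoid[of s0 reg_zeta 0] False by auto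
  obtain d' where d': "d' > 0" "ball s0 d' \<subseteq> {s. Re s > 0}"
    using s0 open_halfspace_Re_gt open_contains_ball by metis
  show ?thesis
  proof (rule that[of "min d d'" reg_zeta 0])
    show "reg_zeta holomorphic_on ball s0 (min d d')"
      by (rule holomorphic_on_subset[OF reg_zeta_holomorphic]) (use d' in auto)
  qed (use d d' False in auto)
qed

text \<open>The inequality \<open>3 + 4 cos \<theta> + cos 2\<theta> = 2 (1 + cos \<theta>)\<^sup>2 \<ge> 0\<close>, summed against \<open>\<Lambda>(n) n\<^sup>-\<^sup>\<sigma>\<close>.\<close>

lemma mangoldt_series_341:
  assumes "x > 1"
  shows "3 * Re (mangoldt_series (of_real x)) + 4 * Re (mangoldt_series (Complex x t))
           + Re (mangoldt_series (Complex x (2 * t))) \<ge> 0"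
proof -
  have sums: "(\<lambda>n. Re (mangoldt n * of_nat n powr (-s))) sums Re (mangoldt_series s)" if "Re s > 1" for s
    unfolding mangoldt_series_def using that
    by (intro sums_Re summable_sums summable_norm_cancel[OF dirichlet_series_norm_summable]
          summable_mangoldt_powr)
  have cos_term: "Re (mangoldt n * of_nat n powr (-Complex x y)) = mangoldt n * real n powr (-x) * cos (y * ln (real n))" for n y
  proof (cases "n = 0")
    case False
    then have "of_nat n powr (-Complex x y) = exp (-Complex x y * ln (real n))"
      by (simp add: powr_def Ln_of_nat)
    moreover have "Re (exp (-Complex x y * ln (real n))) = real n powr (-x) * cos (y * ln (real n))"
      using False by (simp add: Re_exp powr_def)
    ultimately show ?thesis
      by simp
  qed simp
  have "0 \<le> mangoldt n * real n powr (-x) * (2 * (1 + cos (t * ln (real n)))\<^sup>2)" for n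
    by (intro mult_nonneg_nonneg) (auto simp: mangoldt_nonneg)
  also have "\<dots> n = 3 * Re (mangoldt n * of_nat n powr (-Complex x 0))
     + 4 * Re (mangoldt n * of_nat n powr (-Complex x t))
     + Re (mangoldt n * of_nat n powr (-Complex x (2 * t)))" for n
  proof -
    have e: "cos (2 * t * ln (real n)) = 2 * (cos (t * ln (real n)))\<^sup>2 - 1"
      by (simp add: mult.assoc cos_double_cos)
    show ?thesis
      unfolding cos_term e by (simp add: algebra_simps power2_eq_square)
  qed
  finally have "0 \<le> 3 * Re (mangoldt n * of_nat n powr (-Complex x 0))
     + 4 * Re (mangoldt n * of_nat n powr (-Complex x t))
     + Re (mangoldt n * of_nat n powr (-Complex x (2 * t)))" for n .
  moreover have "(\<lambda>n. 3 * Re (mangoldt n * of_nat n powr (-Complex x 0))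
     + 4 * Re (mangoldt n * of_nat n powr (-Complex x t))
     + Re (mangoldt n * of_nat n powr (-Complex x (2 * t)))) sums
       (3 * Re (mangoldt_series (Complex x 0)) + 4 * Re (mangoldt_series (Complex x t))
           + Re (mangoldt_series (Complex x (2 * t))))"
    using assms by (intro sums_add sums_mult sums) auto
  ultimately show ?thesis
    unfolding complex_of_real_def by (rule sums_le[OF _ sums_zero])
qed

text \<open>For Re s > 1 the von Mangoldt series is holomorphic at s, so its residue -m is 0. On the
  line Re s = 1 away from 1, the 3-4-1 inequality is multiplied by e and passed to the limit, which
  compares the residues at 1, 1 + it and 1 + 2it.\<close>

lemma reg_zeta_nonzero:
  assumes "Re s \<ge> 1"
  shows "reg_zeta s \<noteq> 0"
proof (cases "s = 1")
  case True
  then show ?thesis by (simp add: reg_zeta_1)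
next
  case s1: False
  have residue: "\<exists>m. ((\<lambda>e. of_real e * mangoldt_series (s + of_real e)) \<longlongrightarrow>
           (if s = 1 then 1 else 0) - of_nat m) (at_right (0::real)) \<and> (m = 0 \<longleftrightarrow> reg_zeta s \<noteq> 0)"
    if s: "Re s \<ge> 1" for s
  proof -
    obtain m r g where "r > 0" "g holomorphic_on ball s r"
      "\<And>w. w \<in> ball s r \<Longrightarrow> reg_zeta w = (w - s) ^ m * g w"
      "\<And>w. w \<in> ball s r \<Longrightarrow> g w \<noteq> 0" and m: "m = 0 \<longleftrightarrow> reg_zeta s \<noteq> 0"
      by (rule reg_zeta_factor[OF s]) blast
    from mangoldt_series_residue[OF s this(1-4)] m show ?thesis by blast
  qed
  obtain m where m: "((\<lambda>e. of_real e * mangoldt_series (s + of_real e)) \<longlongrightarrow> - of_nat m) (at_right (0::real))"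
    "m = 0 \<longleftrightarrow> reg_zeta s \<noteq> 0"
    using residue[OF assms] s1 by auto
  show ?thesis
  proof (cases "Re s = 1")
    case True
    define t where "t = Im s"
    have s: "s = Complex 1 t" using True by (simp add: t_def complex_eq_iff)
    have t: "t \<noteq> 0" using s s1 by (auto simp: complex_eq_iff)
    obtain m0 where m0: "((\<lambda>e. of_real e * mangoldt_series (1 + of_real e)) \<longlongrightarrow> 1 - of_nat m0) (at_right (0::real))"
        "m0 = 0 \<longleftrightarrow> reg_zeta 1 \<noteq> 0"
      using residue[of 1] by auto
    obtain m2 where m2: "((\<lambda>e. of_real e * mangoldt_series (Complex 1 (2 * t) + of_real e)) \<longlongrightarrow> - of_nat m2) (at_right (0::real))"
      using residue[of "Complex 1 (2 * t)"] t by (auto simp: complex_eq_iff)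
    have "((\<lambda>e. 3 * Re (of_real e * mangoldt_series (1 + of_real e)) + 4 * Re (of_real e * mangoldt_series (s + of_real e))
            + Re (of_real e * mangoldt_series (Complex 1 (2 * t) + of_real e))) \<longlongrightarrow>
          3 * Re (1 - of_nat m0) + 4 * Re (- of_nat m) + Re (- of_nat m2)) (at_right (0::real))"
      by (intro tendsto_intros m m0 m2)
    moreover have "\<forall>\<^sub>F e in at_right (0::real). 3 * Re (of_real e * mangoldt_series (1 + of_real e)) + 4 * Re (of_real e * mangoldt_series (s + of_real e))
            + Re (of_real e * mangoldt_series (Complex 1 (2 * t) + of_real e)) \<ge> 0"
      using eventually_at_right_less[of 0]
    proof eventually_elim
      case (elim e)
      have "s + of_real e = Complex (1 + e) t" "Complex 1 (2 * t) + of_real e = Complex (1 + e) (2 * t)"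
        by (auto simp: s complex_eq_iff)
      then have "3 * Re (of_real e * mangoldt_series (1 + of_real e)) + 4 * Re (of_real e * mangoldt_series (s + of_real e))
            + Re (of_real e * mangoldt_series (Complex 1 (2 * t) + of_real e)) =
          e * (3 * Re (mangoldt_series (of_real (1 + e))) + 4 * Re (mangoldt_series (Complex (1 + e) t))
           + Re (mangoldt_series (Complex (1 + e) (2 * t))))"
        by (simp add: algebra_simps)
      also have "\<dots> \<ge> 0"
        using elim by (intro mult_nonneg_nonneg mangoldt_series_341) auto
      finally show ?case .
    qed
    ultimately have "3 * Re (1 - of_nat m0) + 4 * Re (- of_nat m) + Re (- of_nat m2) \<ge> 0"
      by (intro tendsto_lowerbound) auto
    \<comment> \<open>Since \<open>reg_zeta 1 = 1\<close>, m0 is 0, and the inequality reads 3 - 4m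
      - m2 \<ge> 0.\<close>
    then have "real m = 0"
      using m0 by (simp add: reg_zeta_1)
    then show ?thesis using m by simp
  next
    case False
    then have Re: "Re s > 1" using assms by simp
    have "mangoldt_series holomorphic_on {s. Re s > 1}"
      using dirichlet_series_holomorphic[OF summable_mangoldt_powr]
      by (simp add: mangoldt_series_def [abs_def])
    then have cont: "isCont mangoldt_series s"
      using Re by (metis continuous_on_eq_continuous_at holomorphic_on_imp_continuous_on
            open_halfspace_Re_gt mem_Collect_eq)
    have lim: "((\<lambda>e. s + of_real e) \<longlongrightarrow> s) (at_right (0::real))"
      by (auto intro!: tendsto_eq_intros)
    have "((\<lambda>e. of_real e * mangoldt_series (s + of_real e)) \<longlongrightarrow> of_real 0 * mangoldt_series s) (at_right (0::real))"
      by (intro tendsto_mult tendsto_of_real tendsto_ident_at isCont_tendsto_compose[OF cont lim])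
    with m(1) have "- of_nat m = of_real 0 * mangoldt_series s"
      by (rule tendsto_unique[rotated]) simp
    then show ?thesis using m by simp
  qed
qed

section \<open>Newman's Tauberian theorem\<close>

abbreviation right_arc :: "real \<Rightarrow> real \<Rightarrow> complex" where
  "right_arc R \<equiv> part_circlepath 0 R (-(pi/2)) (pi/2)"

abbreviation left_arc :: "real \<Rightarrow> real \<Rightarrow> complex" where
  "left_arc R \<equiv> part_circlepath 0 R (pi/2) (3*pi/2)"

lemma exp_arc_endpoints:
  "exp (\<i> * complex_of_real (pi/2)) = \<i>" "exp (\<i> * complex_of_real (-(pi/2))) = -\<i>"
  "exp (\<i> * complex_of_real (3*pi/2)) = -\<i>"
proof -
  have "cis (3 * pi / 2) = -\<i>"
    using cis_mult[of pi "pi/2"] by (simp add: cis_pi_half)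
  then show "exp (\<i> * complex_of_real (3*pi/2)) = -\<i>"
    by (simp add: cis_conv_exp)
qed (simp_all only: cis_conv_exp [symmetric] cis_pi_half cis_minus_pi_half)

lemma arc_endpoints:
  "pathstart (right_arc R) = -(\<i> * R)" "pathfinish (right_arc R) = \<i> * R"
  "pathstart (left_arc R) = \<i> * R" "pathfinish (left_arc R) = -(\<i> * R)"
  unfolding pathstart_part_circlepath pathfinish_part_circlepath exp_arc_endpoints by simp_all

lemma path_image_right_arc:
  assumes "z \<in> path_image (right_arc R)" "R > 0"
  shows "norm z = R" "Re z \<ge> 0"
proof -
  obtain t where t: "z = R * exp (\<i> * of_real t)" "t \<in> {-(pi/2)..pi/2}"
    using assms by (auto simp: path_image_part_circlepath' closed_segment_eq_real_ivl cis_conv_exp)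
  show "norm z = R" using t assms by (simp add: norm_mult)
  have "cos t \<ge> 0" using t by (intro cos_ge_zero) auto
  then show "Re z \<ge> 0" using t assms by (simp add: Re_exp)
qed

lemma path_image_left_arc:
  assumes "z \<in> path_image (left_arc R)" "R > 0"
  shows "norm z = R" "Re z \<le> 0"
proof -
  obtain t where t: "z = R * exp (\<i> * of_real t)" "t \<in> {pi/2..3*pi/2}"
    using assms by (auto simp: path_image_part_circlepath' closed_segment_eq_real_ivl cis_conv_exp)
  show "norm z = R" using t assms by (simp add: norm_mult)
  have "cos (t - pi) \<ge> 0" using t by (intro cos_ge_zero) auto
  then have "cos t \<le> 0" by (simp add: cos_diff)
  then show "Re z \<le> 0" using t assms by (simp add: Re_exp mult_nonneg_nonpos)
qed

text \<open>Cauchy's formula with the circle split in two, so that each half can be estimated by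
  itself. The quotient (h(z) - h(0))/z has a removable singularity and integrates to 0; the rest
  h(0)/z contributes i \<pi> h(0) on each arc.\<close>

lemma arcs_cauchy_formula:
  assumes h: "h holomorphic_on UNIV" and "R > 0"
  shows "contour_integral (right_arc R) (\<lambda>z. h z / z) + contour_integral (left_arc R) (\<lambda>z. h z / z)
           = 2 * pi * \<i> * h 0"
proof -
  define q where "q = (\<lambda>z. if z = 0 then deriv h 0 else (h z - h 0) / (z - 0))"
  have "q holomorphic_on UNIV"
    unfolding q_def by (rule pole_lemma[OF h]) auto
  then have "(q has_contour_integral 0) (right_arc R +++ left_arc R)"
    by (rule Cauchy_theorem_convex_simple) (auto simp: arc_endpoints intro!: valid_path_join
        simp del: pathstart_part_circlepath pathfinish_part_circlepath)
  moreover have arc: "\<exists>I. ((\<lambda>z. h z / z) has_contour_integral I) (part_circlepath 0 R a b)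
      \<and> (q has_contour_integral (I - h 0 * (\<i> * (b - a)))) (part_circlepath 0 R a b)"
    if "a < b" for a b
  proof -
    have nz: "z \<noteq> 0" if "z \<in> path_image (part_circlepath 0 R a b)" for z
      using that \<open>R > 0\<close> \<open>a < b\<close> by (auto simp: path_image_part_circlepath)
    have "(\<lambda>z. h z / z) contour_integrable_on (part_circlepath 0 R a b)"
      using h nz by (intro contour_integrable_continuous_part_circlepath continuous_intros)
         (auto intro: holomorphic_on_imp_continuous_on holomorphic_on_subset)
    then obtain I where I: "((\<lambda>z. h z / z) has_contour_integral I) (part_circlepath 0 R a b)"
      by (auto simp: contour_integrable_on_def)
    have "((\<lambda>t. \<i>) has_integral (\<i> * (b - a))) {a..b}"
      using has_integral_const_real[of \<i> a b] that by (simp add: scaleR_conv_of_real mult_ac)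
    then have "((\<lambda>z. 1 / z) has_contour_integral (\<i> * (b - a))) (part_circlepath 0 R a b)"
      using \<open>R > 0\<close> by (simp add: has_contour_integral_part_circlepath_iff[OF that])
    from has_contour_integral_diff[OF I has_contour_integral_lmul[OF this, of "h 0"]]
    have "(q has_contour_integral (I - h 0 * (\<i> * (b - a)))) (part_circlepath 0 R a b)"
      by (rule has_contour_integral_eq) (use nz in \<open>auto simp: q_def diff_divide_distrib\<close>)
    with I show ?thesis by blast
  qed
  obtain I1 where I1: "((\<lambda>z. h z / z) has_contour_integral I1) (right_arc R)"
     "(q has_contour_integral (I1 - h 0 * (\<i> * (pi/2 - -(pi/2))))) (right_arc R)"
    using arc[of "-(pi/2)" "pi/2"] by auto
  obtain I2 where I2: "((\<lambda>z. h z / z) has_contour_integral I2) (left_arc R)"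
     "(q has_contour_integral (I2 - h 0 * (\<i> * (3*pi/2 - pi/2)))) (left_arc R)"
    using arc[of "pi/2" "3*pi/2"] by auto
  have "(q has_contour_integral ((I1 - h 0 * (\<i> * (pi/2 - -(pi/2)))) + (I2 - h 0 * (\<i> * (3*pi/2 - pi/2)))))
          (right_arc R +++ left_arc R)"
    by (intro has_contour_integral_join I1 I2) auto
  ultimately have "(I1 - h 0 * (\<i> * (pi/2 - -(pi/2)))) + (I2 - h 0 * (\<i> * (3*pi/2 - pi/2))) = 0"
    by (metis contour_integral_unique)
  then have "I1 + I2 = 2 * pi * \<i> * h 0"
    by (simp add: field_simps)
  then show ?thesis
    using I1 I2 by (simp add: contour_integral_unique)
qed

text \<open>
  The arc is replaced by the segment on the imaginary axis, where integration by parts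
  gains the factor \<open>1/L\<close>; the boundary terms vanish.
\<close>

lemma right_arc_integral_decay:
  assumes hol: "G holomorphic_on S" and S: "open S" "{z. Re z \<ge> 0} \<subseteq> S" and "R > 0"
    and G0: "G (\<i> * R) = 0" "G (-(\<i> * R)) = 0"
  shows "\<exists>K. \<forall>L>0. norm (contour_integral (right_arc R) (\<lambda>z. G z * exp (of_real L * z))) \<le> K / L"
proof -
  define seg where "seg = closed_segment (\<i> * R) (-(\<i> * R))"
  have Re0: "Re z = 0" if "z \<in> seg" for z
    using that by (auto simp: seg_def closed_segment_def)
  have segS: "seg \<subseteq> S" using Re0 S by auto
  have dhol: "deriv G holomorphic_on S" using hol S(1) by (rule holomorphic_deriv)
  have cont: "continuous_on seg (deriv G)"
    by (rule continuous_on_subset[OF holomorphic_on_imp_continuous_on[OF dhol] segS])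
  have "compact (deriv G ` seg)"
    by (rule compact_continuous_image[OF cont]) (simp add: seg_def)
  then obtain M where M: "\<And>z. z \<in> seg \<Longrightarrow> norm (deriv G z) \<le> M" "M > 0"
    using compact_imp_bounded bounded_pos by (metis image_eqI)
  have "norm (contour_integral (right_arc R) (\<lambda>z. G z * exp (of_real L * z))) \<le> (M * (2 * R)) / L"
    if L: "L > 0" for L
  proof -
    define E where "E = (\<lambda>z::complex. exp (of_real L * z))"
    have E: "norm (E z) = 1" if "z \<in> seg" for z
      using Re0[OF that] by (simp add: E_def)
    have "((\<lambda>z. G z * E z / L) has_field_derivative (deriv G z * E z / L + G z * E z)) (at z within S)"
      if "z \<in> S" for z
    proof -
      have d: "(G has_field_derivative deriv G z) (at z within S)"
        using holomorphic_derivI[OF hol S(1) that] by (rule has_field_derivative_at_within)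
      show ?thesis
        unfolding E_def using L by (auto intro!: derivative_eq_intros d simp: field_simps)
    qed
    \<comment> \<open>The integrand is the derivative of G E / L, whose values at both endpoints
      vanish with G; what remains carries the factor 1/L, and E has modulus 1 on the axis.\<close>
    then have "((\<lambda>z. deriv G z * E z / L + G z * E z) has_contour_integral
        (G (pathfinish (linepath (\<i> * R) (-(\<i> * R)))) * E (pathfinish (linepath (\<i> * R) (-(\<i> * R)))) / L -
         G (pathstart (linepath (\<i> * R) (-(\<i> * R)))) * E (pathstart (linepath (\<i> * R) (-(\<i> * R)))) / L))
        (linepath (\<i> * R) (-(\<i> * R)))"
      by (rule contour_integral_primitive) (use segS in \<open>auto simp: seg_def\<close>)
    then have tot: "((\<lambda>z. deriv G z * E z / L + G z * E z) has_contour_integral 0) (linepath (\<i> * R) (-(\<i> * R)))"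
      using G0 by simp
    have "(\<lambda>z. deriv G z * E z / L) contour_integrable_on (linepath (\<i> * R) (-(\<i> * R)))"
      by (intro contour_integrable_continuous_linepath)
         (use L cont in \<open>auto simp: seg_def E_def intro!: continuous_intros\<close>)
    then obtain I where I: "((\<lambda>z. deriv G z * E z / L) has_contour_integral I) (linepath (\<i> * R) (-(\<i> * R)))"
      by (auto simp: contour_integrable_on_def)
    have "norm I \<le> M / L * norm (-(\<i> * R) - \<i> * R)"
    proof (rule has_contour_integral_bound_linepath[OF I])
      fix z assume "z \<in> closed_segment (\<i> * R) (-(\<i> * R))"
      then show "norm (deriv G z * E z / L) \<le> M / L"
        using M(1)[of z] E[of z] L by (simp add: norm_mult norm_divide seg_def divide_right_mono)
    qed (use M L in auto)
    also have "-(\<i> * R) - \<i> * R = - (\<i> * of_real (2 * R))" by simp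
    also have "norm \<dots> = 2 * R" using \<open>R > 0\<close> by (simp only: norm_minus_cancel norm_mult norm_ii norm_of_real)
    finally have bnd: "norm I \<le> (M * (2 * R)) / L" by simp
    have seg_int: "((\<lambda>z. G z * E z) has_contour_integral (- I)) (linepath (\<i> * R) (-(\<i> * R)))"
      using has_contour_integral_diff[OF tot I] by simp
    have img: "path_image (right_arc R) \<subseteq> {z. Re z \<ge> 0}"
      using path_image_right_arc \<open>R > 0\<close> by auto
    have holGE: "(\<lambda>z. G z * E z) holomorphic_on {z. Re z \<ge> 0}"
      unfolding E_def by (intro holomorphic_intros holomorphic_on_subset[OF hol S(2)])
    have "(\<lambda>z. G z * E z) contour_integrable_on right_arc R"
      by (intro contour_integrable_continuous_part_circlepath
          continuous_on_subset[OF holomorphic_on_imp_continuous_on[OF holGE] img])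
    then obtain J where J: "((\<lambda>z. G z * E z) has_contour_integral J) (right_arc R)"
      by (auto simp: contour_integrable_on_def)
    have "((\<lambda>z. G z * E z) has_contour_integral 0) (right_arc R +++ linepath (\<i> * R) (-(\<i> * R)))"
    proof (rule Cauchy_theorem_convex_simple[OF holGE])
      show "convex {z. Re z \<ge> 0}" by (rule convex_halfspace_Re_ge)
      have "seg \<subseteq> {z. Re z \<ge> 0}" using Re0 by auto
      then show "path_image (right_arc R +++ linepath (\<i> * R) (-(\<i> * R))) \<subseteq> {z. Re z \<ge> 0}"
        using img path_image_join_subset[of "right_arc R" "linepath (\<i> * R) (-(\<i> * R))"]
        unfolding seg_def path_image_linepath by blast
    qed (auto simp: arc_endpoints intro!: valid_path_join
        simp del: pathstart_part_circlepath pathfinish_part_circlepath)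
    moreover have "((\<lambda>z. G z * E z) has_contour_integral (J + - I)) (right_arc R +++ linepath (\<i> * R) (-(\<i> * R)))"
      by (intro has_contour_integral_join J seg_int) auto
    ultimately have "J + - I = 0" by (metis contour_integral_unique)
    then show ?thesis
      using bnd J by (simp add: contour_integral_unique E_def)
  qed
  then show ?thesis by blast
qed

section \<open>Comparison of power sums with integrals\<close>

lemma powr_diff_mvt:
  fixes a p :: real
  assumes "a > 0"
  obtains \<xi> where "a < \<xi>" "\<xi> < a + 1" "(a + 1) powr p - a powr p = p * \<xi> powr (p - 1)"
proof -
  have "\<exists>\<xi>>a. \<xi> < a + 1 \<and> (a + 1) powr p - a powr p = (a + 1 - a) * (p * \<xi> powr (p - 1))"
    by (rule MVT2) (use assms in \<open>auto intro!: derivative_eq_intros\<close>)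
  with that show ?thesis by auto
qed

text \<open>For y \<ge> 1 the summands increase, and the integral bounds all but the last one, which
  is added separately; for y < 1 they decrease and the integral alone suffices.\<close>

lemma sum_powr_le:
  assumes y: "y > 0"
  shows "(\<Sum>n=1..N. real n powr (y - 1)) \<le> real N powr y / y + real N powr (y - 1)"
proof (cases "y \<ge> 1")
  case True
  show ?thesis
  proof (induction N)
    case (Suc N)
    show ?case
    proof (cases "N = 0")
      case False
      then obtain \<xi> where \<xi>: "real N < \<xi>" "(real N + 1) powr y - real N powr y = y * \<xi> powr (y - 1)"
        using powr_diff_mvt[of "real N" y] by auto
      have "real N powr (y - 1) \<le> \<xi> powr (y - 1)"
        using \<xi> True by (intro powr_mono2) auto
      also have "\<dots> = (real N + 1) powr y / y - real N powr y / y"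
        using \<xi>(2) y by (simp add: field_simps)
      finally show ?thesis using Suc by (simp add: add_ac)
    qed (use y in auto)
  qed auto
next
  case False
  have "(\<Sum>n=1..N. real n powr (y - 1)) \<le> real N powr y / y"
  proof (induction N)
    case (Suc N)
    show ?case
    proof (cases "N = 0")
      case False': False
      then obtain \<xi> where \<xi>: "real N < \<xi>" "\<xi> < real N + 1" "(real N + 1) powr y - real N powr y = y * \<xi> powr (y - 1)"
        using powr_diff_mvt[of "real N" y] by auto
      have "(real N + 1) powr (y - 1) \<le> \<xi> powr (y - 1)"
        using \<xi> False by (intro powr_mono2') auto
      also have "\<dots> = (real N + 1) powr y / y - real N powr y / y"
        using \<xi>(3) y by (simp add: field_simps)
      finally show ?thesis using Suc by (simp add: add_ac)
    qed (use y False in auto)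
  qed auto
  then show ?thesis by (smt (verit) powr_ge_zero)
qed

text \<open>By the mean value theorem (n+1)^(-x-1) is at most (n^(-x) - (n+1)^(-x))/x, and these
  bounds telescope from N on.\<close>

lemma norm_dirichlet_tail_le:
  fixes b :: "nat \<Rightarrow> complex"
  assumes b: "\<And>n. norm (b n) \<le> C" and z: "Re z > 0" and N: "N > 0"
    and s: "(\<lambda>n. b n * of_nat n powr (-z - 1)) sums s"
  shows "norm (s - (\<Sum>n=1..N. b n * of_nat n powr (-z - 1))) \<le> C * real N powr (-Re z) / Re z"
proof -
  define x where "x = Re z"
  define t where "t = (\<lambda>n. b n * of_nat n powr (-z - 1))"
  have C: "C \<ge> 0" using b[of 0] norm_ge_zero order_trans by blast
  \<comment> \<open>The term at index 0 vanishes, so sums from 0 and from 1 agree.\<close>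
  have "{..<Suc N} = insert 0 {1..N}" by auto
  then have "(\<Sum>n<Suc N. t n) = (\<Sum>n=1..N. t n)" by (simp add: t_def)
  then have tail: "(\<lambda>n. t (n + Suc N)) sums (s - (\<Sum>n=1..N. t n))"
    using sums_split_initial_segment[OF s[folded t_def], of "Suc N"] by simp
  have "(\<lambda>n. real (n + N) powr (-x)) \<longlonglongrightarrow> 0"
    using z LIMSEQ_ignore_initial_segment[OF tendsto_neg_powr[OF _ filterlim_real_sequentially, of "-x"], of N]
    by (simp add: x_def)
  from telescope_sums'[OF this]
  have tel: "(\<lambda>n. real (n + N) powr (-x) - real (Suc n + N) powr (-x)) sums (real N powr (-x))"
    by simp
  have le: "norm (t (n + Suc N)) \<le> C / x * (real (n + N) powr (-x) - real (Suc n + N) powr (-x))" for n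
  proof -
    obtain \<xi> where \<xi>: "real (n + N) < \<xi>" "\<xi> < real (n + N) + 1"
       "(real (n + N) + 1) powr (-x) - real (n + N) powr (-x) = - x * \<xi> powr (-x - 1)"
      using powr_diff_mvt[of "real (n + N)" "-x"] N by auto
    have "norm (t (n + Suc N)) \<le> C * real (n + Suc N) powr (-x - 1)"
      unfolding t_def norm_mult norm_of_nat_powr using b by (intro mult_mono) (auto simp: x_def C)
    also have "real (n + Suc N) powr (-x - 1) \<le> \<xi> powr (-x - 1)"
      using \<xi> z N by (intro powr_mono2') (auto simp: x_def)
    also have "C * \<xi> powr (-x - 1) = C / x * (real (n + N) powr (-x) - real (Suc n + N) powr (-x))"
    proof -
      have "real (n + N) powr (-x) - real (Suc n + N) powr (-x) = x * \<xi> powr (-x - 1)"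
        using \<xi>(3) by (simp add: add_ac)
      then show ?thesis using z by (simp add: x_def)
    qed
    finally show ?thesis using C by (simp add: mult_left_mono)
  qed
  have "norm (s - (\<Sum>n=1..N. t n)) \<le> C / x * (real N powr (-x))"
    using tail sums_mult[OF tel, of "C / x"] norm_suminf_le[of "\<lambda>n. t (n + Suc N)", OF le]
    by (simp add: sums_iff)
  then show ?thesis by (simp add: t_def x_def)
qed

lemma norm_dirichlet_head_le:
  fixes b :: "nat \<Rightarrow> complex"
  assumes b: "\<And>n. norm (b n) \<le> C" and z: "Re z < 0"
  shows "norm (\<Sum>n=1..N. b n * of_nat n powr (-z - 1)) \<le>
           C * (real N powr (-Re z) / (-Re z) + real N powr (-Re z - 1))"
proof -
  have C: "C \<ge> 0" using b[of 0] norm_ge_zero order_trans by blast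
  have "norm (\<Sum>n=1..N. b n * of_nat n powr (-z - 1)) \<le> (\<Sum>n=1..N. C * real n powr (-Re z - 1))"
    by (intro sum_norm_le) (auto simp: norm_mult norm_of_nat_powr intro!: mult_right_mono b)
  also have "\<dots> = C * (\<Sum>n=1..N. real n powr (-Re z - 1))"
    by (rule sum_distrib_left [symmetric])
  also have "\<dots> \<le> C * (real N powr (-Re z) / (-Re z) + real N powr (-Re z - 1))"
    using z by (intro mult_left_mono sum_powr_le C) auto
  finally show ?thesis .
qed

section \<open>Newman's kernel and the contour estimate\<close>

text \<open>On the circle R^2 is z times its conjugate, so 1/z + z/R^2 is real. Its factor Re z
  cancels the 1/Re z in the bounds for the tail and for the partial sum.\<close>

lemma newman_kernel:
  assumes "norm z = R" "R > 0"
  shows "(1 + z\<^sup>2 / of_real R ^ 2) / z = of_real (2 * Re z / R\<^sup>2)"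
proof -
  have "z \<noteq> 0" using assms by auto
  have "of_real R ^ 2 = z * cnj z"
    using assms complex_norm_square[of z] by simp
  then have "(1 + z\<^sup>2 / of_real R ^ 2) / z = (z + cnj z) / of_real R ^ 2"
    using \<open>z \<noteq> 0\<close> by (simp add: field_simps power2_eq_square)
  then show ?thesis by (simp add: complex_add_cnj)
qed

text \<open>
  Cauchy's formula is applied to the entire function \<open>f(0) - f\<^sub>N(z)\<close> on the full circle, with the
  kernel \<open>N\<^sup>z (1/z + z/R\<^sup>2)\<close>, where \<open>f\<^sub>N\<close> is the partial sum. On the right arc
  \<open>f(0) - f\<^sub>N(z) = (f(z) - f\<^sub>N(z)) - (f(z) - f(0))\<close>: the first part is a tail of the series, and
  \<open>(f(z) - f(0))/z\<close> is regular, so that the decay lemma applies to the second.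
\<close>

lemma newman_estimate:
  fixes b :: "nat \<Rightarrow> complex"
  assumes b: "\<And>n. norm (b n) \<le> C"
    and hol: "f holomorphic_on S" and S: "open S" "{z. Re z \<ge> 0} \<subseteq> S"
    and f: "\<And>z. Re z > 0 \<Longrightarrow> (\<lambda>n. b n * of_nat n powr (-z - 1)) sums f z"
    and R: "R > 0"
  shows "\<exists>K. \<forall>N\<ge>2. norm (f 0 - (\<Sum>n=1..N. b n * of_nat n powr (-0 - 1))) \<le> 2 * C / R + K / ln (real N)"
proof -
  have C: "C \<ge> 0" using b[of 0] norm_ge_zero order_trans by blast
  define k where "k = (\<lambda>z::complex. 1 + z\<^sup>2 / of_real R ^ 2)"
  define g where "g = (\<lambda>z. if z = 0 then deriv f 0 else (f z - f 0) / (z - 0))"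
  define G where "G = (\<lambda>z. g z * k z)"
  have "0 \<in> interior S" using S by (simp add: interior_open) (use S in auto)
  then have "g holomorphic_on S"
    unfolding g_def by (intro pole_lemma hol)
  then have G: "G holomorphic_on S"
    unfolding G_def k_def by (intro holomorphic_intros) (use R in auto)
  have "k (\<i> * R) = 0" "k (-(\<i> * R)) = 0" using R by (auto simp: k_def power_mult_distrib)
  then have "G (\<i> * R) = 0" "G (-(\<i> * R)) = 0" by (auto simp: G_def)
  from right_arc_integral_decay[OF G S R this] obtain K1 where
    K1: "\<And>L. L > 0 \<Longrightarrow> norm (contour_integral (right_arc R) (\<lambda>z. G z * exp (of_real L * z))) \<le> K1 / L"
    by blast
  \<comment> \<open>\<open>K2\<close> is the coefficient of 1/ln N in the pointwise bound on the
    left arc; \<open>K\<close> adds the segment contribution, with arc length \<pi> R and the factor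
    2 \<pi> of Cauchy's formula divided out.\<close>
  define K2 where "K2 = 2 * C / R + 2 * norm (f 0) / R\<^sup>2"
  define K where "K = (K1 + K2 * (R * pi)) / (2 * pi)"
  have "norm (f 0 - (\<Sum>n=1..N. b n * of_nat n powr (-0 - 1))) \<le> 2 * C / R + K / ln (real N)" if N: "N \<ge> 2" for N
  proof -
    define L where "L = ln (real N)"
    have L: "L > 0" using N by (simp add: L_def)
    have L_le: "L \<le> real N" using N ln_le_minus_one[of "real N"] by (simp add: L_def)
    define P where "P = (\<lambda>z::complex. exp (of_real L * z))"
    define fN where "fN = (\<lambda>z. \<Sum>n=1..N. b n * of_nat n powr (-z - 1))"
    define h where "h = (\<lambda>z. (f 0 - fN z) * (k z * P z))"
    have normP: "norm (P z) = real N powr Re z" for z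
      using N by (simp add: P_def L_def powr_def mult.commute)
    have hol_fN: "fN holomorphic_on A" for A
      unfolding fN_def by (intro holomorphic_intros)
    have hol_kP: "(\<lambda>z. k z * P z) holomorphic_on A" for A
      unfolding k_def P_def by (intro holomorphic_intros) (use R in auto)
    have hol_h: "h holomorphic_on A" for A
      unfolding h_def by (intro holomorphic_intros hol_fN hol_kP)
    have h0: "h 0 = f 0 - fN 0" by (simp add: h_def k_def P_def)
    have kernel: "norm (k z * P z / z) = real N powr Re z * (2 * \<bar>Re z\<bar> / R\<^sup>2)" if "norm z = R" for z
    proof -
      have "k z * P z / z = (k z / z) * P z" by simp
      also have "k z / z = of_real (2 * Re z / R\<^sup>2)"
        unfolding k_def by (rule newman_kernel[OF that R])
      finally have "k z * P z / z = of_real (2 * Re z / R\<^sup>2) * P z" .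
      moreover have "norm (of_real (2 * Re z / R\<^sup>2) :: complex) = 2 * \<bar>Re z\<bar> / R\<^sup>2"
        unfolding norm_of_real by (simp add: abs_mult)
      ultimately show ?thesis
        by (simp only: norm_mult normP mult.commute)
    qed
    \<comment> \<open>The bounds divide by Re z, which vanishes on the circle only at these two
      points; they are left out as a finite exceptional set.\<close>
    have axis: "z \<in> {\<i> * R, -(\<i> * R)}" if "norm z = R" "Re z = 0" for z
    proof -
      have "R\<^sup>2 = (Im z)\<^sup>2" using that by (metis cmod_power2 add_0 zero_power2)
      then have "Im z = R \<or> Im z = -R" by (metis power2_eq_iff)
      then show ?thesis using that by (auto simp: complex_eq_iff)
    qed
    have imgR: "path_image (right_arc R) \<subseteq> {z. Re z \<ge> 0} - {0}"
      using path_image_right_arc R by fastforce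
    have imgL: "path_image (left_arc R) \<subseteq> UNIV - {0}"
      using path_image_left_arc R by fastforce
    have "(\<lambda>z. (f z - fN z) * (k z * P z) / z) holomorphic_on {z. Re z \<ge> 0} - {0}"
      by (intro holomorphic_intros hol_fN hol_kP holomorphic_on_subset[OF hol]) (use S in auto)
    then have int1: "(\<lambda>z. (f z - fN z) * (k z * P z) / z) contour_integrable_on right_arc R"
      by (intro contour_integrable_continuous_part_circlepath
          continuous_on_subset[OF holomorphic_on_imp_continuous_on imgR])
    have int2: "(\<lambda>z. G z * P z) contour_integrable_on right_arc R"
    proof -
      have "(\<lambda>z. G z * P z) holomorphic_on {z. Re z \<ge> 0} - {0}"
        unfolding P_def by (intro holomorphic_intros holomorphic_on_subset[OF G]) (use S in auto)
      then show ?thesis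
        by (intro contour_integrable_continuous_part_circlepath
            continuous_on_subset[OF holomorphic_on_imp_continuous_on imgR])
    qed
    have "(\<lambda>z. h z / z) holomorphic_on UNIV - {0}"
      by (intro holomorphic_intros hol_h) auto
    then have int3: "(\<lambda>z. h z / z) contour_integrable_on left_arc R"
      by (intro contour_integrable_continuous_part_circlepath
          continuous_on_subset[OF holomorphic_on_imp_continuous_on imgL])
    have "contour_integral (right_arc R) (\<lambda>z. h z / z) =
        contour_integral (right_arc R) (\<lambda>z. (f z - fN z) * (k z * P z) / z - G z * P z)"
    proof (rule contour_integral_cong)
      fix z assume "z \<in> path_image (right_arc R)"
      then have "z \<noteq> 0" using imgR by auto
      then show "h z / z = (f z - fN z) * (k z * P z) / z - G z * P z"
        by (simp add: h_def G_def g_def field_simps)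
    qed auto
    also have "\<dots> = contour_integral (right_arc R) (\<lambda>z. (f z - fN z) * (k z * P z) / z) -
                    contour_integral (right_arc R) (\<lambda>z. G z * P z)"
      by (rule contour_integral_diff[OF int1 int2])
    finally have "2 * pi * \<i> * (f 0 - fN 0) =
        contour_integral (right_arc R) (\<lambda>z. (f z - fN z) * (k z * P z) / z) -
        contour_integral (right_arc R) (\<lambda>z. G z * P z) + contour_integral (left_arc R) (\<lambda>z. h z / z)"
      using arcs_cauchy_formula[OF hol_h R] h0 by simp
    then have "norm (2 * pi * \<i> * (f 0 - fN 0)) \<le>
        norm (contour_integral (right_arc R) (\<lambda>z. (f z - fN z) * (k z * P z) / z)) +
        norm (contour_integral (right_arc R) (\<lambda>z. G z * P z)) + norm (contour_integral (left_arc R) (\<lambda>z. h z / z))"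
      by (simp only:) (intro norm_triangle_le add_right_mono norm_triangle_ineq4)
    moreover have "norm (contour_integral (right_arc R) (\<lambda>z. G z * P z)) \<le> K1 / L"
      unfolding P_def by (rule K1[OF L])
    moreover have "norm (contour_integral (right_arc R) (\<lambda>z. (f z - fN z) * (k z * P z) / z))
        \<le> (2 * C / R\<^sup>2) * R * (pi/2 - -(pi/2))"
    proof (rule contour_integral_bound_part_circlepath_strong[OF int1, of "{\<i> * R, -(\<i> * R)}"])
      fix z assume z: "z \<in> path_image (right_arc R) - {\<i> * R, -(\<i> * R)}"
      then have nz: "norm z = R" "Re z \<ge> 0" using path_image_right_arc[of z R] R by auto
      with z axis have x: "Re z > 0" by force
      have "norm ((f z - fN z) * (k z * P z) / z) = norm (f z - fN z) * norm (k z * P z / z)"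
        by (simp add: norm_mult norm_divide)
      \<comment> \<open>Tail and kernel are reciprocal in both N^(Re z) and Re z, so the product is
        bounded uniformly along the arc.\<close>
      also have "\<dots> \<le> (C * real N powr (-Re z) / Re z) * (real N powr Re z * (2 * \<bar>Re z\<bar> / R\<^sup>2))"
        unfolding fN_def kernel[OF nz(1)]
        using norm_dirichlet_tail_le[OF b x _ f[OF x]] N by (intro mult_right_mono) auto
      also have "\<dots> = 2 * C / R\<^sup>2 * (real N powr (-Re z) * real N powr Re z)"
        using x by simp
      also have "real N powr (-Re z) * real N powr Re z = 1"
        using N by (simp flip: powr_add)
      finally show "norm ((f z - fN z) * (k z * P z) / z) \<le> 2 * C / R\<^sup>2" by simp
    qed (use C R in auto)
    moreover have "norm (contour_integral (left_arc R) (\<lambda>z. h z / z)) \<le>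
        (2 * C / R\<^sup>2 + K2 / L) * R * (3*pi/2 - pi/2)"
    proof (rule contour_integral_bound_part_circlepath_strong[OF int3, of "{\<i> * R, -(\<i> * R)}"])
      fix z assume z: "z \<in> path_image (left_arc R) - {\<i> * R, -(\<i> * R)}"
      then have nz: "norm z = R" "Re z \<le> 0" using path_image_left_arc[of z R] R by auto
      with z axis have x: "Re z < 0" by force
      define y where "y = -Re z"
      have y: "y > 0" "y \<le> R" using x nz abs_Re_le_cmod[of z] by (auto simp: y_def)
      have NN: "real N powr y * real N powr (-y) = 1" "real N powr (y - 1) * real N powr (-y) = 1 / real N"
        using N by (simp_all add: powr_minus_divide powr_diff)
      \<comment> \<open>From t \<le> exp t with t = y L: the constant f(0) costs only O(1/L) on the
        left arc, even near the axis.\<close>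
      have yL: "y * real N powr (-y) \<le> 1 / L"
      proof -
        have "y * L \<le> exp (y * L)" using exp_ge_add_one_self[of "y * L"] by linarith
        then have "y * L * exp (-(y * L)) \<le> 1" by (simp add: exp_minus field_simps)
        moreover have "real N powr (-y) = exp (-(y * L))" using N by (simp add: powr_def L_def)
        ultimately show ?thesis using L by (simp add: field_simps)
      qed
      have "norm (f 0 - fN z) \<le> norm (f 0) + norm (fN z)"
        by (rule norm_triangle_ineq4)
      also have "norm (fN z) \<le> C * (real N powr y / y + real N powr (y - 1))"
        unfolding fN_def y_def by (rule norm_dirichlet_head_le[OF b x])
      finally have f0: "norm (f 0 - fN z) \<le> norm (f 0) + C * (real N powr y / y + real N powr (y - 1))" by simp
      have "norm (h z / z) = norm (f 0 - fN z) * norm (k z * P z / z)"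
        by (simp add: h_def norm_mult norm_divide)
      also have "\<dots> \<le> (norm (f 0) + C * (real N powr y / y + real N powr (y - 1))) *
           (real N powr (-y) * (2 * y / R\<^sup>2))"
      proof -
        have "norm (k z * P z / z) = real N powr (-y) * (2 * y / R\<^sup>2)"
          using x by (simp add: kernel[OF nz(1)] y_def)
        then show ?thesis using y by (simp only:) (intro mult_right_mono f0, simp)
      qed
      also have "\<dots> = 2 * norm (f 0) / R\<^sup>2 * (y * real N powr (-y)) +
           2 * C / R\<^sup>2 * (real N powr y * real N powr (-y)) +
           2 * C / R\<^sup>2 * y * (real N powr (y - 1) * real N powr (-y))"
        using y by (simp add: distrib_left distrib_right mult_ac add_divide_distrib)
      \<comment> \<open>Only the middle summand fails to decay with N; the last one uses y \<le> R
        and 1/N \<le> 1/L.\<close>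
      also have "\<dots> \<le> 2 * norm (f 0) / R\<^sup>2 * (1 / L) + 2 * C / R\<^sup>2 * 1 + 2 * C / R\<^sup>2 * R * (1 / L)"
        unfolding NN using y C R L L_le N
        by (intro add_mono mult_mono yL mult_left_mono divide_left_mono) auto
      also have "\<dots> = 2 * C / R\<^sup>2 + K2 / L"
        using R L by (simp add: K2_def field_simps power2_eq_square)
      finally show "norm (h z / z) \<le> 2 * C / R\<^sup>2 + K2 / L" .
    qed (use C R L in \<open>auto simp: K2_def\<close>)
    ultimately have "norm (2 * pi * \<i> * (f 0 - fN 0)) \<le>
        (2 * C / R\<^sup>2) * R * (pi/2 - -(pi/2)) + K1 / L + (2 * C / R\<^sup>2 + K2 / L) * R * (3*pi/2 - pi/2)"
      by linarith
    also have "\<dots> = 2 * pi * (2 * C / R + K / L)"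
      using R L by (simp add: K_def field_simps power2_eq_square)
    finally have "2 * pi * norm (f 0 - fN 0) \<le> 2 * pi * (2 * C / R + K / L)"
      by (simp add: norm_mult)
    then show ?thesis by (simp add: fN_def L_def)
  qed
  then show ?thesis by blast
qed

text \<open>In \<open>newman_estimate\<close> the radius is fixed first, large enough to make 2C/R
  small; then N tends to infinity and removes the term K / ln N.\<close>

theorem newman_tauberian:
  fixes b :: "nat \<Rightarrow> complex"
  assumes b: "\<And>n. norm (b n) \<le> C"
    and hol: "f holomorphic_on S" and S: "open S" "{z. Re z \<ge> 0} \<subseteq> S"
    and f: "\<And>z. Re z > 0 \<Longrightarrow> (\<lambda>n. b n * of_nat n powr (-z - 1)) sums f z"
  shows "(\<lambda>N. \<Sum>n=1..N. b n / of_nat n) \<longlonglongrightarrow> f 0"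
proof (rule LIMSEQ_I)
  fix e :: real assume e: "e > 0"
  have C: "C \<ge> 0" using b[of 0] norm_ge_zero order_trans by blast
  \<comment> \<open>Chosen to make 2C/R \<le> e/2; the 1 added to C keeps R positive when C =
    0.\<close>
  define R where "R = 4 * (C + 1) / e"
  have R: "R > 0" using e C by (simp add: R_def)
  have "2 * C / R \<le> e / 2" using e C by (simp add: R_def field_simps)
  obtain K where K: "\<And>N. N \<ge> 2 \<Longrightarrow> norm (f 0 - (\<Sum>n=1..N. b n * of_nat n powr (-0 - 1))) \<le> 2 * C / R + K / ln (real N)"
    using newman_estimate[OF b hol S f R] by blast
  have "(\<lambda>N. K / ln (real N)) \<longlonglongrightarrow> 0" by real_asymp
  then have "\<forall>\<^sub>F N in sequentially. K / ln (real N) < e / 2"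
    by (rule order_tendstoD) (use e in auto)
  then obtain N0 where N0: "\<And>N. N \<ge> N0 \<Longrightarrow> K / ln (real N) < e / 2"
    by (auto simp: eventually_sequentially)
  have powr: "(of_nat n :: complex) powr (-0 - 1) = 1 / of_nat n" for n
    by (simp add: powr_minus_divide)
  have "norm ((\<Sum>n=1..N. b n / of_nat n) - f 0) < e" if "N \<ge> max 2 N0" for N
  proof -
    have "norm (f 0 - (\<Sum>n=1..N. b n / of_nat n)) \<le> 2 * C / R + K / ln (real N)"
      using K[of N] that unfolding powr by simp
    also have "K / ln (real N) < e / 2" using N0 that by auto
    also have "2 * C / R + e / 2 \<le> e" using \<open>2 * C / R \<le> e / 2\<close> by linarith
    finally show ?thesis by (simp only: norm_minus_commute)
  qed
  then show "\<exists>no. \<forall>n\<ge>no. norm ((\<Sum>n=1..n. b n / of_nat n) - f 0) < e" by blast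
qed

section \<open>Asymptotics of psi\<close>

definition psi_err :: "nat \<Rightarrow> real" where
  "psi_err n = psi n - real n"

lemma abs_psi_err_le: "\<bar>psi_err n\<bar> \<le> 3 * real n"
  using psi_le[of n] psi_nonneg[of n] by (auto simp: psi_err_def)

text \<open>Abel summation: the coefficients \<Lambda>(n) - 1 have partial sums psi(n) - n, and by
  Chebyshev's bound the boundary term is O(N^(1 - Re s)).\<close>

lemma mangoldt_minus_zeta_sums:
  assumes s: "Re s > 1"
  shows "(\<lambda>n. of_real (psi_err n) * (of_nat n powr (-s) - of_nat (Suc n) powr (-s))) sums
           (mangoldt_series s - zeta_series s)"
proof -
  define v where "v = (\<lambda>n. of_nat n powr (-s) :: complex)"
  \<comment> \<open>Subtracting 0 instead of 1 at index 0 makes the partial sums exactly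
    \<open>psi_err\<close>; the series is unaffected because \<open>0 powr (-s) = 0\<close>.\<close>
  define a where "a = (\<lambda>n. mangoldt n - (if n = 0 then 0 else 1) :: complex)"
  have sum_a: "(\<Sum>k<Suc n. a k) = of_real (psi_err n)" for n
  proof -
    have "(\<Sum>k\<le>n. if k = 0 then 0 else 1 :: complex) = of_nat n"
      by (induction n) auto
    then show ?thesis
      by (simp add: a_def sum_subtractf psi_err_def psi_def lessThan_Suc_atMost)
  qed
  have abel: "(\<Sum>n<N. of_real (psi_err n) * (v n - v (Suc n))) = (\<Sum>n<N. a n * v n) - (\<Sum>k<N. a k) * v N" for N
  proof (induction N)
    case (Suc N)
    have "of_real (psi_err N) = (\<Sum>k<N. a k) + a N" using sum_a[of N] by simp
    then show ?case using Suc by (simp add: algebra_simps)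
  qed simp
  have av: "a n * v n = mangoldt n * of_nat n powr (-s) - of_nat n powr (-s)" for n
    by (auto simp: a_def v_def algebra_simps)
  have "(\<lambda>n. a n * v n) sums (mangoldt_series s - zeta_series s)"
    unfolding av mangoldt_series_def zeta_series_def
    by (intro sums_diff summable_sums summable_norm_cancel[OF summable_norm_zeta[OF s]]
          summable_norm_cancel[OF dirichlet_series_norm_summable[OF summable_mangoldt_powr s]])
  then have "(\<lambda>N. \<Sum>n<N. a n * v n) \<longlonglongrightarrow> mangoldt_series s - zeta_series s"
    by (simp add: sums_def)
  moreover have "(\<lambda>N. (\<Sum>k<N. a k) * v N) \<longlonglongrightarrow> 0"
  proof (rule Lim_null_comparison)
    show "\<forall>\<^sub>F N in sequentially. norm ((\<Sum>k<N. a k) * v N) \<le> 3 * norm (of_nat N powr (1 - s) :: complex)"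
      using eventually_gt_at_top[of 0]
    proof eventually_elim
      case (elim N)
      then obtain n where n: "N = Suc n" by (cases N) auto
      have "norm (\<Sum>k<N. a k) \<le> 3 * real N"
        using abs_psi_err_le[of n] unfolding n sum_a norm_of_real by simp
      then have "norm ((\<Sum>k<N. a k) * v N) \<le> 3 * real N * real N powr (- Re s)"
        unfolding norm_mult v_def norm_of_nat_powr by (intro mult_mono) auto
      also have "\<dots> = 3 * norm (of_nat N powr (1 - s) :: complex)"
        using elim unfolding norm_of_nat_powr by (simp add: powr_diff powr_minus_divide)
      finally show ?case .
    qed
    show "(\<lambda>N. 3 * norm (of_nat N powr (1 - s) :: complex)) \<longlonglongrightarrow> 0"
      using s by (intro tendsto_mult_right_zero tendsto_norm_zero powr_tendsto_0) auto
  qed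
  ultimately have "(\<lambda>N. (\<Sum>n<N. a n * v n) - (\<Sum>k<N. a k) * v N) \<longlonglongrightarrow> mangoldt_series s - zeta_series s - 0"
    by (rule tendsto_diff)
  then have "(\<lambda>n. of_real (psi_err n) * (v n - v (Suc n))) sums (mangoldt_series s - zeta_series s)"
    by (simp add: sums_def abel)
  then show ?thesis by (simp only: v_def)
qed

text \<open>Since s n^(-s-1) is the Euler term plus n^(-s) - (n+1)^(-s), the series with terms
  psi_err(n) n^(-s-1) splits into \<open>H\<close>, holomorphic for Re s > 0 by Chebyshev's bound,
  and the Abel-summed series. Newman's theorem is applied after the shift s = z + 1.\<close>

lemma psi_err_series_convergent: "convergent (\<lambda>N. \<Sum>n=1..N. psi_err n / (real n)\<^sup>2)"
proof -
  define b where "b = (\<lambda>n. of_real (psi_err n / real n) :: complex)"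
  define H where "H = (\<lambda>s. \<Sum>n. of_real (psi_err n) * euler_term n s)"
  \<comment> \<open>The poles of 1/(s - 1) and zeta(s) at 1 combine to -(G(s) - G(1))/(s - 1),
    because G(1) = 1; \<open>q\<close> fills in the removable singularity.\<close>
  define q where "q = (\<lambda>s. if s = 1 then deriv reg_zeta 1 else (reg_zeta s - reg_zeta 1) / (s - 1))"
  \<comment> \<open>An open set on which G'/G is holomorphic; it contains Re s \<ge> 1 because G is
    zero-free there.\<close>
  define \<Omega> where "\<Omega> = {s. Re s > 0} \<inter> reg_zeta -` (- {0})"
  define F where "F = (\<lambda>s. (H s - q s - deriv reg_zeta s / reg_zeta s) / s)"
  have op: "open {s. Re s > 0}" by (rule open_halfspace_Re_gt)
  have err: "norm (complex_of_real (psi_err n)) \<le> 3 * real n powr 1" if "n > 0" for n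
    using abs_psi_err_le[of n] by simp
  have Hhol: "H holomorphic_on {s. Re s > 0}"
    using euler_term_series_holomorphic[of "\<lambda>n. of_real (psi_err n)" 3 1, OF err] by (simp add: H_def)
  have Hsum: "(\<lambda>n. of_real (psi_err n) * euler_term n s) sums H s" if "Re s > 1" for s
    unfolding H_def using that
    by (intro summable_sums euler_term_series_summable[of _ 3 1, OF err]) auto
  have qhol: "q holomorphic_on {s. Re s > 0}"
    unfolding q_def by (rule pole_lemma[OF reg_zeta_holomorphic]) (simp add: interior_open[OF op])
  have \<Omega>: "open \<Omega>"
    unfolding \<Omega>_def
    by (rule continuous_open_preimage[OF holomorphic_on_imp_continuous_on[OF reg_zeta_holomorphic] op]) auto
  have "\<Omega> \<subseteq> {s. Re s > 0}" "\<And>s. s \<in> \<Omega> \<Longrightarrow> reg_zeta s \<noteq> 0" "\<And>s. s \<in> \<Omega> \<Longrightarrow> s \<noteq> 0"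
    by (auto simp: \<Omega>_def)
  then have Fhol: "F holomorphic_on \<Omega>"
    unfolding F_def
    by (intro holomorphic_intros holomorphic_on_subset[OF Hhol] holomorphic_on_subset[OF qhol]
          holomorphic_on_subset[OF reg_zeta_holomorphic]
          holomorphic_on_subset[OF holomorphic_deriv[OF reg_zeta_holomorphic op]]) auto
  have Fsum: "(\<lambda>n. b n * of_nat n powr (-s)) sums F s" if s: "Re s > 1" for s
  proof -
    have nz: "s \<noteq> 0" "s \<noteq> 1" "reg_zeta s \<noteq> 0" using s reg_zeta_nonzero[of s] by auto
    have L: "mangoldt_series s = 1 / (s - 1) - deriv reg_zeta s / reg_zeta s"
      using mangoldt_series_times_reg_zeta[OF s] nz by (simp add: field_simps)
    have Z: "zeta_series s = reg_zeta s / (s - 1)"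
      using reg_zeta_eq[OF s] nz by simp
    have D: "mangoldt_series s - zeta_series s = - q s - deriv reg_zeta s / reg_zeta s"
      using nz(2) by (simp add: L Z q_def reg_zeta_1 diff_divide_distrib)
    have "(\<lambda>n. of_real (psi_err n) * euler_term n s +
             of_real (psi_err n) * (of_nat n powr (-s) - of_nat (Suc n) powr (-s))) sums
            (H s + (mangoldt_series s - zeta_series s))"
      by (intro sums_add Hsum mangoldt_minus_zeta_sums s)
    also have "(\<lambda>n. of_real (psi_err n) * euler_term n s +
             of_real (psi_err n) * (of_nat n powr (-s) - of_nat (Suc n) powr (-s))) =
           (\<lambda>n. s * (b n * of_nat n powr (-s)))"
    proof
      fix n :: nat
      show "of_real (psi_err n) * euler_term n s +
             of_real (psi_err n) * (of_nat n powr (-s) - of_nat (Suc n) powr (-s)) =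
           s * (b n * of_nat n powr (-s))"
      proof (cases "n = 0")
        \<comment> \<open>At n = 0 the Euler term is the stray constant 1, but its coefficient
          \<open>psi_err 0\<close> is 0.\<close>
        case True
        then show ?thesis by (simp add: psi_err_def psi_def)
      next
        case False
        have "of_nat n powr (-s - 1) = of_nat n powr (-s) / (of_nat n :: complex)"
          using False by (simp add: powr_diff)
        then show ?thesis by (simp add: euler_term_def b_def algebra_simps)
      qed
    qed
    finally have "(\<lambda>n. s * (b n * of_nat n powr (-s)) / s) sums ((H s + (mangoldt_series s - zeta_series s)) / s)"
      by (rule sums_divide)
    then show ?thesis
      using nz(1) by (simp add: D F_def algebra_simps)
  qed
  have "(\<lambda>N. \<Sum>n=1..N. b n / of_nat n) \<longlonglongrightarrow> (F \<circ> (\<lambda>z. z + 1)) 0"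
  proof (rule newman_tauberian)
    show "norm (b n) \<le> 3" for n
      using abs_psi_err_le[of n] by (cases "n = 0") (auto simp: b_def norm_divide field_simps)
    show "(F \<circ> (\<lambda>z. z + 1)) holomorphic_on ((\<lambda>z. z + 1) -` \<Omega>)"
      by (rule holomorphic_on_compose_gen[OF _ Fhol]) (auto intro!: holomorphic_intros)
    show "open ((\<lambda>z. z + 1) -` \<Omega>)"
      by (rule open_vimage[OF \<Omega>]) (intro continuous_intros)
    show "{z. Re z \<ge> 0} \<subseteq> (\<lambda>z. z + 1) -` \<Omega>"
      using reg_zeta_nonzero by (auto simp: \<Omega>_def)
    show "(\<lambda>n. b n * of_nat n powr (-z - 1)) sums (F \<circ> (\<lambda>z. z + 1)) z" if "Re z > 0" for z
      using Fsum[of "z + 1"] that by simp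
  qed
  from tendsto_Re[OF this] have "(\<lambda>N. \<Sum>n=1..N. Re (b n / of_nat n)) \<longlonglongrightarrow> Re ((F \<circ> (\<lambda>z. z + 1)) 0)"
    by (simp only: Re_sum)
  also have "(\<lambda>n. Re (b n / of_nat n)) = (\<lambda>n. psi_err n / (real n)\<^sup>2)"
  proof
    fix n
    have "b n / of_nat n = of_real (psi_err n / (real n)\<^sup>2)"
      by (simp add: b_def power2_eq_square)
    then show "Re (b n / of_nat n) = psi_err n / (real n)\<^sup>2" by (simp only: Re_complex_of_real)
  qed
  finally show ?thesis by (auto simp: convergent_def)
qed

section \<open>From convergence of the series to psi(n) ~ n\<close>

lemma psi_err_block:
  assumes "e > 0"
  shows "\<exists>M. \<forall>m n. M \<le> m \<longrightarrow> m \<le> n \<longrightarrow> \<bar>\<Sum>k=m..n. psi_err k / (real k)\<^sup>2\<bar> < e"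
proof -
  have "Cauchy (\<lambda>N. \<Sum>n=1..N. psi_err n / (real n)\<^sup>2)"
    using psi_err_series_convergent by (simp add: Cauchy_convergent_iff)
  from CauchyD[OF this assms] obtain M where
    M: "\<And>m n. m \<ge> M \<Longrightarrow> n \<ge> M \<Longrightarrow> norm ((\<Sum>n=1..m. psi_err n / (real n)\<^sup>2) - (\<Sum>n=1..n. psi_err n / (real n)\<^sup>2)) < e"
    by blast
  have "\<bar>\<Sum>k=m..n. psi_err k / (real k)\<^sup>2\<bar> < e" if "M + 1 \<le> m" "m \<le> n" for m n
  proof -
    have "{1..n} = {1..m-1} \<union> {m..n}" using that by auto
    then have "(\<Sum>k=1..n. psi_err k / (real k)\<^sup>2) = (\<Sum>k=1..m-1. psi_err k / (real k)\<^sup>2) + (\<Sum>k=m..n. psi_err k / (real k)\<^sup>2)"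
      using that by (simp only:) (intro sum.union_disjoint, auto)
    then show ?thesis using M[of n "m - 1"] that by (simp add: abs_minus_commute)
  qed
  then show ?thesis by blast
qed

text \<open>If psi(N) exceeded (1 + 2e) N, monotonicity would keep psi(k) - k \<ge> e N for all k
  from N to (1 + e) N. These more than e N - 1 terms would form a block bounded away from 0, against
  the Cauchy criterion.\<close>

lemma psi_upper:
  assumes e: "e > 0"
  shows "\<forall>\<^sub>F N in sequentially. psi N \<le> (1 + 2 * e) * real N"
proof -
  \<comment> \<open>The threshold is the size of the hypothetical block: e N times the term bound e
    N / ((1 + e) N)^2.\<close>
  obtain M where M: "\<And>m n. M \<le> m \<Longrightarrow> m \<le> n \<Longrightarrow> \<bar>\<Sum>k=m..n. psi_err k / (real k)\<^sup>2\<bar> < e\<^sup>2 / (1 + e)\<^sup>2"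
    using psi_err_block[of "e\<^sup>2 / (1 + e)\<^sup>2"] e by auto
  have "psi N \<le> (1 + 2 * e) * real N" if N: "N \<ge> max M 1" for N
  proof (rule ccontr)
    assume "\<not> ?thesis"
    then have big: "psi N > (1 + 2 * e) * real N" by simp
    define d where "d = nat \<lfloor>e * real N\<rfloor>"
    have d: "real d \<le> e * real N" "e * real N \<le> real d + 1"
      using e N by (auto simp: d_def)
    have "e\<^sup>2 / u\<^sup>2 = (e * x) * (e * x / (u * x)\<^sup>2)" if "u > 0" "x > 0" for u x :: real
      using that by (simp add: field_simps power2_eq_square)
    from this[of "1 + e" "real N"]
    have "e\<^sup>2 / (1 + e)\<^sup>2 = (e * real N) * (e * real N / ((1 + e) * real N)\<^sup>2)"
      using N e by simp
    also have "\<dots> \<le> (real d + 1) * (e * real N / ((1 + e) * real N)\<^sup>2)"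
      using d e by (intro mult_right_mono) auto
    also have "\<dots> = (\<Sum>k=N..N+d. e * real N / ((1 + e) * real N)\<^sup>2)"
      by simp
    also have "\<dots> \<le> (\<Sum>k=N..N+d. psi_err k / (real k)\<^sup>2)"
    proof (intro sum_mono frac_le power_mono)
      fix k assume k: "k \<in> {N..N+d}"
      then have "real k \<le> real N + real d" by (simp flip: of_nat_add)
      then show kb: "real k \<le> (1 + e) * real N" using d by (simp add: algebra_simps)
      have "psi k \<ge> psi N" using k by (intro psi_mono) auto
      then show le: "e * real N \<le> psi_err k"
        using big kb by (simp add: psi_err_def algebra_simps)
      show "0 \<le> psi_err k"
        using le e by (smt (verit) mult_nonneg_nonneg of_nat_0_le_iff)
      show "0 < (real k)\<^sup>2" using k N by simp
    qed auto
    finally show False using M[of N "N + d"] N by simp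
  qed
  then show ?thesis unfolding eventually_sequentially by blast
qed

text \<open>The mirror image of \<open>psi_upper\<close>: a deficit at N persists for k from (1 - e)
  N up to N, where the denominators are at most N^2.\<close>

lemma psi_lower:
  assumes e: "e > 0" "e < 1 / 2"
  shows "\<forall>\<^sub>F N in sequentially. psi N \<ge> (1 - 2 * e) * real N"
proof -
  obtain M where M: "\<And>m n. M \<le> m \<Longrightarrow> m \<le> n \<Longrightarrow> \<bar>\<Sum>k=m..n. psi_err k / (real k)\<^sup>2\<bar> < e\<^sup>2"
    using psi_err_block[of "e\<^sup>2"] e by auto
  have "psi N \<ge> (1 - 2 * e) * real N" if N: "N \<ge> 2 * M + 2" for N
  proof (rule ccontr)
    assume "\<not> ?thesis"
    then have small: "psi N < (1 - 2 * e) * real N" by simp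
    define d where "d = nat \<lfloor>e * real N\<rfloor>"
    have d: "real d \<le> e * real N" "e * real N \<le> real d + 1"
      using e N by (auto simp: d_def)
    have "e * real N \<le> 1 / 2 * real N" using e by (intro mult_right_mono) auto
    then have "2 * real d \<le> real N" using d by simp
    \<comment> \<open>Because e < 1/2 the block stays above N/2, hence beyond M.\<close>
    then have dN: "2 * d \<le> N" by linarith
    have "e\<^sup>2 = (e * real N) * (e * real N / (real N)\<^sup>2)"
      using N e by (simp add: field_simps power2_eq_square)
    also have "\<dots> \<le> (real d + 1) * (e * real N / (real N)\<^sup>2)"
      using d e by (intro mult_right_mono) auto
    also have "\<dots> = (\<Sum>k=N-d..N. e * real N / (real N)\<^sup>2)"
      using dN by (simp add: of_nat_diff)
    also have "\<dots> \<le> (\<Sum>k=N-d..N. - psi_err k / (real k)\<^sup>2)"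
    proof (intro sum_mono frac_le power_mono)
      fix k assume k: "k \<in> {N-d..N}"
      then have Nk: "N \<le> k + d" by auto
      then have "real N \<le> real k + real d" by linarith
      then have kb: "real k \<ge> (1 - e) * real N" using d by (simp add: algebra_simps)
      have "psi k \<le> psi N" using k by (intro psi_mono) auto
      then show le: "e * real N \<le> - psi_err k"
        using small kb by (simp add: psi_err_def algebra_simps)
      show "0 \<le> - psi_err k"
        using le e by (smt (verit) mult_nonneg_nonneg of_nat_0_le_iff)
      have "k > 0" using Nk N dN by linarith
      then show "0 < (real k)\<^sup>2" by simp
    qed auto
    also have "\<dots> = - (\<Sum>k=N-d..N. psi_err k / (real k)\<^sup>2)"
      by (simp add: sum_negf)
    finally show False using M[of "N - d" N] N dN by linarith
  qed
  then show ?thesis unfolding eventually_sequentially by blast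
qed

theorem psi_asymptotics: "(\<lambda>n. psi n / real n) \<longlonglongrightarrow> 1"
proof (rule tendstoI)
  fix r :: real assume r: "r > 0"
  define e where "e = min (r / 3) (1 / 3)"
  have e: "e > 0" "e < 1 / 2" "2 * e < r" using r by (auto simp: e_def)
  show "\<forall>\<^sub>F n in sequentially. dist (psi n / real n) 1 < r"
    using psi_upper[OF e(1)] psi_lower[OF e(1,2)] eventually_gt_at_top[of 0]
  proof eventually_elim
    case (elim n)
    then have "psi n / real n \<le> 1 + 2 * e" "psi n / real n \<ge> 1 - 2 * e"
      by (auto simp: field_simps)
    then show ?case using e(3) by (auto simp: dist_real_def)
  qed
qed

section \<open>The prime number theorem and iterated primes\<close>

definition prime_count :: "nat \<Rightarrow> nat" where
  "prime_count x = card {p. prime p \<and> p \<le> x}"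

text \<open>Grouping the prime powers up to x by their prime p, there are at most K = floor(ln x /
  ln p) of them, so each prime contributes at most K ln p \<le> ln x.\<close>

lemma psi_le_prime_count:
  assumes "x > 0"
  shows "psi x \<le> real (prime_count x) * ln (real x)"
proof -
  define Q where "Q = {q. primepow q \<and> q \<le> x}"
  define A where "A = {p. prime p \<and> p \<le> x}"
  have fin: "finite Q" "finite A" by (auto simp: Q_def A_def)
  have sub: "aprimedivisor ` Q \<subseteq> A"
  proof
    fix p assume "p \<in> aprimedivisor ` Q"
    then obtain q where q: "primepow q" "q \<le> x" "p = aprimedivisor q" by (auto simp: Q_def)
    from q(1) obtain r k where r: "prime r" "k > 0" "q = r ^ k" by (auto simp: primepow_def)
    then have "p = r" using q by (simp add: aprimedivisor_prime_power)
    moreover have "r \<le> q" using r(2,3) prime_ge_1_nat[OF r(1)] self_le_power[of r k] by simp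
    ultimately show "p \<in> A" using q r by (simp add: A_def)
  qed
  have "psi x = (\<Sum>q\<in>Q. ln (real (aprimedivisor q)))"
    unfolding psi_def by (rule sum.mono_neutral_cong_right) (auto simp: Q_def mangoldt_def)
  also have "\<dots> = (\<Sum>p\<in>A. \<Sum>q | q \<in> Q \<and> aprimedivisor q = p. ln (real (aprimedivisor q)))"
    by (rule sum.group [symmetric]) (use fin sub in auto)
  also have "\<dots> \<le> (\<Sum>p\<in>A. ln (real x))"
  proof (rule sum_mono)
    fix p assume "p \<in> A"
    then have p: "prime p" by (simp add: A_def)
    then have p1: "p > 1" by (rule prime_gt_1_nat)
    then have lnp: "ln (real p) > 0" by simp
    define K where "K = nat \<lfloor>ln (real x) / ln (real p)\<rfloor>"
    define B where "B = {q \<in> Q. aprimedivisor q = p}"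
    have K: "real K * ln (real p) \<le> ln (real x)"
    proof -
      have "ln (real x) / ln (real p) \<ge> 0" using assms lnp by simp
      then have "real K \<le> ln (real x) / ln (real p)" by (simp add: K_def)
      then show ?thesis using lnp by (simp add: field_simps)
    qed
    have "B \<subseteq> (\<lambda>k. p ^ k) ` {1..K}"
    proof
      fix q assume "q \<in> B"
      then have q: "primepow q" "q \<le> x" "aprimedivisor q = p" by (auto simp: B_def Q_def)
      from q obtain r k where rk: "prime r" "k > 0" "q = r ^ k" by (auto simp: primepow_def)
      then have "r = p" using q by (simp add: aprimedivisor_prime_power)
      then have qk: "q = p ^ k" using rk by simp
      have "real k * ln (real p) = ln (real q)" using p1 by (simp add: qk ln_realpow)
      also have "\<dots> \<le> ln (real x)"
      proof -
        have "q > 0" using qk p1 by simp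
        then show ?thesis using q(2) by simp
      qed
      finally have "real k \<le> ln (real x) / ln (real p)" using lnp by (simp add: field_simps)
      then have "k \<le> K" unfolding K_def by (simp add: le_nat_floor)
      then show "q \<in> (\<lambda>k. p ^ k) ` {1..K}" using qk rk(2) by auto
    qed
    then have "card B \<le> card {1..K}"
      using card_image_le[of "{1..K}" "\<lambda>k. p ^ k"] card_mono[of "(\<lambda>k. p ^ k) ` {1..K}" B] by simp
    then have "real (card B) * ln (real p) \<le> real K * ln (real p)"
      using lnp by simp
    also have "real (card B) * ln (real p) = (\<Sum>q\<in>B. ln (real (aprimedivisor q)))"
      by (simp add: B_def)
    finally show "(\<Sum>q | q \<in> Q \<and> aprimedivisor q = p. ln (real (aprimedivisor q))) \<le> ln (real x)"
      using K unfolding B_def by linarith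
  qed
  also have "\<dots> = real (prime_count x) * ln (real x)"
    by (simp add: prime_count_def A_def)
  finally show ?thesis .
qed

text \<open>There are at most x^d primes up to x^d, and every larger prime up to x contributes at
  least d ln x to psi(x).\<close>

lemma prime_count_le:
  assumes x: "x > 1" and d: "0 < d"
  shows "real (prime_count x) \<le> real x powr d + psi x / (d * ln (real x))"
proof -
  define A where "A = {p. prime p \<and> p \<le> x \<and> real p \<le> real x powr d}"
  define B where "B = {p. prime p \<and> p \<le> x \<and> real p > real x powr d}"
  have fin: "finite A" "finite B" by (auto simp: A_def B_def)
  have lnx: "ln (real x) > 0" using x by simp
  have "prime_count x = card (A \<union> B)"
    unfolding prime_count_def by (rule arg_cong[where f = card]) (auto simp: A_def B_def)
  also have "\<dots> \<le> card A + card B" by (rule card_Un_le)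
  finally have "real (prime_count x) \<le> real (card A) + real (card B)" by linarith
  moreover have "real (card A) \<le> real x powr d"
  proof -
    have "A \<subseteq> {1..nat \<lfloor>real x powr d\<rfloor>}"
      by (auto simp: A_def le_nat_floor prime_ge_1_nat dest: prime_gt_0_nat)
    then have "card A \<le> nat \<lfloor>real x powr d\<rfloor>" using card_mono[of "{1..nat \<lfloor>real x powr d\<rfloor>}" A] by simp
    then show ?thesis by (meson le_nat_floor of_nat_floor of_nat_le_iff order_trans powr_ge_zero)
  qed
  moreover have "real (card B) * (d * ln (real x)) \<le> psi x"
  proof -
    have "real (card B) * (d * ln (real x)) = (\<Sum>p\<in>B. d * ln (real x))" by simp
    also have "\<dots> \<le> (\<Sum>p\<in>B. mangoldt p)"
    proof (rule sum_mono)
      fix p assume p: "p \<in> B"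
      then have "real p > real x powr d" by (simp add: B_def)
      moreover have "real x powr d > 0" using x by simp
      ultimately have "ln (real x powr d) \<le> ln (real p)"
        by (intro ln_mono less_imp_le) auto
      then show "d * ln (real x) \<le> mangoldt p"
        using x p by (simp add: ln_powr B_def)
    qed
    also have "\<dots> \<le> psi x"
      unfolding psi_def by (rule sum_mono2) (auto simp: B_def mangoldt_nonneg)
    finally show ?thesis .
  qed
  then have "real (card B) \<le> psi x / (d * ln (real x))"
    using lnx d by (simp add: pos_le_divide_eq)
  ultimately show ?thesis by linarith
qed

theorem prime_number_theorem:
  "(\<lambda>x. real (prime_count x) * ln (real x) / real x) \<longlonglongrightarrow> 1"
proof (rule order_tendstoI)
  fix a :: real assume "a < 1"
  then have "\<forall>\<^sub>F x in sequentially. psi x / real x > a"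
    by (rule order_tendstoD(1)[OF psi_asymptotics])
  then show "\<forall>\<^sub>F x in sequentially. real (prime_count x) * ln (real x) / real x > a"
    using eventually_gt_at_top[of 0]
  proof eventually_elim
    case (elim x)
    then have "psi x / real x \<le> real (prime_count x) * ln (real x) / real x"
      by (intro divide_right_mono psi_le_prime_count) auto
    then show ?case using elim by linarith
  qed
next
  fix a :: real assume a: "a > 1"
  \<comment> \<open>Then 1/d = (1 + a)/2 lies strictly between 1 and a: d < 1 makes x^(d-1) ln x
    vanish in the limit, and 1/d < a leaves room for the strict bound.\<close>
  define d where "d = 2 / (1 + a)"
  have d: "0 < d" "d < 1" "1 / d < a" using a by (auto simp: d_def)
  have "(\<lambda>x. real x powr (d - 1) * ln (real x)) \<longlonglongrightarrow> 0"
    using d by real_asymp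
  from tendsto_add[OF this tendsto_divide[OF psi_asymptotics tendsto_const[of d]]]
  have "(\<lambda>x. real x powr (d - 1) * ln (real x) + psi x / real x / d) \<longlonglongrightarrow> 1 / d"
    using d by simp
  from order_tendstoD(2)[OF this d(3)]
  show "\<forall>\<^sub>F x in sequentially. real (prime_count x) * ln (real x) / real x < a"
    using eventually_gt_at_top[of 1]
  proof eventually_elim
    case (elim x)
    have "real (prime_count x) * ln (real x) / real x \<le> (real x powr d + psi x / (d * ln (real x))) * ln (real x) / real x"
      using elim d by (intro divide_right_mono mult_right_mono prime_count_le) auto
    also have "\<dots> = real x powr (d - 1) * ln (real x) + psi x / real x / d"
      using elim d by (simp add: powr_diff field_simps)
    finally show ?case using elim by linarith
  qed
qed

section \<open>From prime counting to the n-th prime\<close>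

lemma prime_count_nth_prime:
  assumes "n \<ge> 1"
  shows "prime_count (nth_prime n) = n"
proof -
  let ?e = "enumerate {p::nat. prime p}"
  have "{p. prime p \<and> p \<le> nth_prime n} = ?e ` {..<n}"
  proof safe
    fix p :: nat assume p: "prime p" "p \<le> nth_prime n"
    then obtain k where k: "?e k = p" using enumerate_Ex[of "{p::nat. prime p}" p] primes_infinite by auto
    \<comment> \<open>The enumeration is strictly increasing and indexed from 0, so the primes up to
      the n-th one have indices 0 to n - 1.\<close>
    then have "k \<le> n - 1" using p primes_infinite by (simp add: nth_prime_def flip: k)
    then show "p \<in> ?e ` {..<n}" using k assms by auto
  next
    fix k assume "k < n"
    then show "?e k \<le> nth_prime n" using primes_infinite by (simp add: nth_prime_def)
    show "prime (?e k)" using enumerate_in_set[OF primes_infinite, of k] by simp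
  qed
  moreover have "inj_on ?e {..<n}"
    using inj_enumerate[OF primes_infinite] by (rule inj_on_subset) auto
  ultimately show ?thesis by (simp add: prime_count_def card_image)
qed

lemma nth_prime_at_top: "filterlim nth_prime at_top at_top"
proof (rule filterlim_at_top_mono)
  show "filterlim (\<lambda>n::nat. n - 1) at_top at_top" by (rule filterlim_minus_const_nat_at_top)
  show "\<forall>\<^sub>F n in at_top. n - 1 \<le> nth_prime n"
    by (auto simp: nth_prime_def le_enumerate primes_infinite)
qed

text \<open>Putting x = p_n in the prime number theorem gives n ln p_n / p_n \<rightarrow> 1. Taking
  logarithms and dividing by ln p_n yields ln n / ln p_n \<rightarrow> 1, and then ln n may replace
  ln p_n in the first relation.\<close>

lemma nth_prime_asymp:
  shows ln_nth_prime_asymp: "(\<lambda>n. ln (real (nth_prime n))) \<sim>[at_top] (\<lambda>n. ln (real n))"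
    and nth_prime_asymp_equiv: "(\<lambda>n. real (nth_prime n)) \<sim>[at_top] (\<lambda>n. real n * ln (real n))"
proof -
  define p where "p = (\<lambda>n. real (nth_prime n))"
  have p_top: "filterlim p at_top at_top"
    unfolding p_def by (rule filterlim_compose[OF filterlim_real_sequentially nth_prime_at_top])
  have "(\<lambda>n. real (prime_count (nth_prime n)) * ln (p n) / p n) \<longlonglongrightarrow> 1"
    unfolding p_def by (rule filterlim_compose[OF prime_number_theorem nth_prime_at_top])
  then have r: "(\<lambda>n. real n * ln (p n) / p n) \<longlonglongrightarrow> 1"
    by (rule Lim_transform_eventually)
       (auto intro!: eventually_mono[OF eventually_ge_at_top[of 1]] simp: prime_count_nth_prime)
  then have lnr: "(\<lambda>n. ln (real n * ln (p n) / p n)) \<longlonglongrightarrow> 0"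
    using tendsto_ln[OF r] by simp
  have ln_top: "filterlim (\<lambda>n. ln (p n)) at_top at_top"
    by (rule filterlim_compose[OF ln_at_top p_top])
  have "(\<lambda>n. ln (real n * ln (p n) / p n) / ln (p n)) \<longlonglongrightarrow> 0"
    by (rule tendsto_divide_0[OF lnr filterlim_at_top_imp_at_infinity[OF ln_top]])
  moreover have "(\<lambda>n. ln (ln (p n)) / ln (p n)) \<longlonglongrightarrow> 0"
  proof -
    have "((\<lambda>x::real. ln x / x) \<longlongrightarrow> 0) at_top" by real_asymp
    from filterlim_compose[OF this ln_top] show ?thesis .
  qed
  \<comment> \<open>Expanding the logarithm of the quotient collapses this expression to ln n / ln
    p_n.\<close>
  ultimately have "(\<lambda>n. 1 + ln (real n * ln (p n) / p n) / ln (p n) - ln (ln (p n)) / ln (p n)) \<longlonglongrightarrow> 1 + 0 - 0"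
    by (intro tendsto_intros)
  then have "(\<lambda>n. ln (real n) / ln (p n)) \<longlonglongrightarrow> 1"
  unfolding add_0_right diff_0_right
  proof (rule Lim_transform_eventually)
    have "\<forall>\<^sub>F n in at_top. p n > 1" "\<forall>\<^sub>F n in at_top. ln (p n) > 0"
      using p_top ln_top by (auto simp: filterlim_at_top_dense)
    then show "\<forall>\<^sub>F n in sequentially. 1 + ln (real n * ln (p n) / p n) / ln (p n) - ln (ln (p n)) / ln (p n) = ln (real n) / ln (p n)"
      using eventually_gt_at_top[of 0]
    proof eventually_elim
      case (elim n)
      then have "ln (real n * ln (p n) / p n) = ln (real n) + ln (ln (p n)) - ln (p n)"
        by (simp add: ln_div ln_mult)
      then show ?case using elim by (simp add: field_simps)
    qed
  qed
  then have *: "(\<lambda>n. ln (real n)) \<sim>[at_top] (\<lambda>n. ln (p n))"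
    by (rule asymp_equivI')
  then show "(\<lambda>n. ln (real (nth_prime n))) \<sim>[at_top] (\<lambda>n. ln (real n))"
    unfolding p_def by (rule asymp_equiv_symI)
  have "(\<lambda>n. real n * ln (p n)) \<sim>[at_top] p"
    using r by (rule asymp_equivI')
  then have "p \<sim>[at_top] (\<lambda>n. real n * ln (p n))" by (rule asymp_equiv_symI)
  also have "(\<lambda>n. real n * ln (p n)) \<sim>[at_top] (\<lambda>n. real n * ln (real n))"
    by (intro asymp_equiv_intros asymp_equiv_symI[OF *])
  finally show "(\<lambda>n. real (nth_prime n)) \<sim>[at_top] (\<lambda>n. real n * ln (real n))"
    by (simp add: p_def)
qed

section \<open>Iterated primes\<close>

lemma iter_prime_at_top: "filterlim (iter_prime k) at_top at_top"
proof (induction k)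
  case 0
  then show ?case by (simp add: iter_prime_def [abs_def] filterlim_ident)
next
  case (Suc k)
  then show ?case
    using filterlim_compose[OF nth_prime_at_top Suc] by (simp add: iter_prime_def [abs_def])
qed

text \<open>Both claims go through one induction: the step for the main term multiplies the
  asymptotics of the k-th iterate by those of its logarithm.\<close>

lemma iter_prime_asymp:
  "(\<lambda>n. real (iter_prime k n)) \<sim>[at_top] (\<lambda>n. real n * ln (real n) ^ k) \<and>
   (\<lambda>n. ln (real (iter_prime k n))) \<sim>[at_top] (\<lambda>n. ln (real n))"
proof (induction k)
  case 0
  then show ?case by (simp add: iter_prime_def)
next
  case (Suc k)
  have step: "iter_prime (Suc k) n = nth_prime (iter_prime k n)" for n
    by (simp add: iter_prime_def)
  have "(\<lambda>n. real (nth_prime (iter_prime k n))) \<sim>[at_top] (\<lambda>n. real (iter_prime k n) * ln (real (iter_prime k n)))"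
    by (rule asymp_equiv_compose'[OF nth_prime_asymp_equiv iter_prime_at_top])
  also have "\<dots> \<sim>[at_top] (\<lambda>n. (real n * ln (real n) ^ k) * ln (real n))"
    by (intro asymp_equiv_mult) (use Suc in auto)
  finally have 1: "(\<lambda>n. real (iter_prime (Suc k) n)) \<sim>[at_top] (\<lambda>n. real n * ln (real n) ^ Suc k)"
    by (simp add: step mult_ac)
  have "(\<lambda>n. ln (real (nth_prime (iter_prime k n)))) \<sim>[at_top] (\<lambda>n. ln (real (iter_prime k n)))"
    by (rule asymp_equiv_compose'[OF ln_nth_prime_asymp iter_prime_at_top])
  also have "\<dots> \<sim>[at_top] (\<lambda>n. ln (real n))" using Suc by blast
  finally show ?case using 1 by (simp add: step)
qed

theorem theorem1:
  fixes k :: nat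
  shows "(\<lambda>n. real (iter_prime k n)) \<sim>[at_top] (\<lambda>n. real n * ln (real n) ^ k)
       \<and> (\<lambda>n. real (iter_prime k (Suc n))) \<sim>[at_top] (\<lambda>n. real (iter_prime k n))
       \<and> (\<lambda>n. ln (real (iter_prime k n))) \<sim>[at_top] (\<lambda>n. ln (real n))"
proof (intro conjI)
  show 1: "(\<lambda>n. real (iter_prime k n)) \<sim>[at_top] (\<lambda>n. real n * ln (real n) ^ k)"
    and "(\<lambda>n. ln (real (iter_prime k n))) \<sim>[at_top] (\<lambda>n. ln (real n))"
    using iter_prime_asymp[of k] by auto
  \<comment> \<open>The first claim is read at n + 1; it then remains to compare the elementary main
    terms at n + 1 and n.\<close>
  have "(\<lambda>n. real (iter_prime k (Suc n))) \<sim>[at_top] (\<lambda>n. real (Suc n) * ln (real (Suc n)) ^ k)"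
    by (rule asymp_equiv_compose'[OF 1 filterlim_Suc])
  also have "\<dots> \<sim>[at_top] (\<lambda>n. real n * ln (real n) ^ k)"
  proof (intro asymp_equiv_intros)
    show "(\<lambda>n. real (Suc n)) \<sim>[at_top] real" by real_asymp
    show "(\<lambda>n. ln (real (Suc n))) \<sim>[at_top] (\<lambda>n. ln (real n))" by real_asymp
  qed
  also have "\<dots> \<sim>[at_top] (\<lambda>n. real (iter_prime k n))"
    by (rule asymp_equiv_symI[OF 1])
  finally show "(\<lambda>n. real (iter_prime k (Suc n))) \<sim>[at_top] (\<lambda>n. real (iter_prime k n))" .
qed

end
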